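(* Suppose assumptions (A1)–(A4) of the context hold, and run META-STORM-SG (defined in the context) for $T$ iterations with $p\in[\frac14,\frac12]$, $p+2q=1$. Let $\hat p=\frac{2(1-p)}3\in[\frac13,\frac12]$. When $\sigma\neq0$ and $T$ is big enough, $$\mathbb E\big[\|\nabla F(x_{\rm out})\|^{2\hat p}\big]=O\Big((F(x_1)-F^* )^{\frac{\hat p}{1-p}}+\beta^{\frac{\hat p}{p}}\log^{\frac{\hat p}{1-p}}\beta+\beta^{\frac{\hat p}{p}}\log^{\frac{\hat p}{1-p}}(1+\sigma^2T)\Big)\Big(\frac1{T^{\hat p}}+\frac{\sigma^{2\hat p/3}}{T^{2\hat p/3}}\Big).$$
   Context: Setting. $\mathcal D$ is a probability distribution; for each $\xi\in\mathrm{support}(\mathcal D)$, $f(\cdot,\xi):\mathbb R^d\to\mathbb R$ is differentiable; $F(x)=\mathbb E_{\xi\sim\mathcal D}[f(x,\xi)]$ (possibly non-convex), differentiable. $\|\cdot\|$ is the Euclidean norm, $[T]=\{1,\dots,T\}$; $\log^{r}(u)$ means $(\log u)^r$. In the first factor, $O(\cdot)$ indicates only the dependency on $\beta$ and $F(x_1)-F^*$ (besides $\log(1+\sigma^2T)$); dependency on the other parameters is suppressed. Assumptions. (A1) $F^*:=\inf_x F(x)>-\infty$. (A2) $\mathbb E_\xi[\nabla f(x,\xi)]=\nabla F(x)$ and $\mathbb E_\xi\|\nabla f(x,\xi)-\nabla F(x)\|^2\le\sigma^2$ for all $x$, with $\sigma\ge0$. (A3) $\mathbb E_\xi\|\nabla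 f(x,\xi)-\nabla f(y,\xi)\|^2\le\beta^2\|x-y\|^2$ for all $x,y\in\mathbb R^d$. (A4) $\|\nabla f(x,\xi)\|\le\widehat G$ for all $x\in\mathbb R^d$, $\xi\in\mathrm{support}(\mathcal D)$, with $\widehat G\ge0$. Algorithm META-STORM-SG. Input: $x_1\in\mathbb R^d$; parameters $a_0,b_0,\eta>0$, $p\in[\frac14,\frac12]$, $q$ with $p+2q=1$. Let $\xi_1,\xi_2,\dots$ be i.i.d. from $\mathcal D$, $d_1=\nabla f(x_1,\xi_1)$. For $t=1,\dots,T$: $a_{t+1}=\big(1+\sum_{i=1}^t\|\nabla f(x_i,\xi_i)\|^2/a_0^2\big)^{-2/3}$; $b_t=\big(b_0^{1/p}+\sum_{i=1}^t\|d_i\|^2\big)^p/a_{t+1}^q$; $x_{t+1}=x_t-\frac{\eta}{b_t}d_t$; $d_{t+1}=\nabla f(x_{t+1},\xi_{t+1})+(1-a_{t+1})(d_t-\nabla f(x_t,\xi_{t+1}))$. Output $x_{\rm out}=x_t$ with $t$ uniform on $[T]$. *)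

theory Defs
  imports "HOL-Probability.Probability"
begin

definition gradient :: "('a::euclidean_space \<Rightarrow> real) \<Rightarrow> 'a \<Rightarrow> 'a" where
  "gradient h x = (THE g. GDERIV h x :> g)"

lemma gradient_eqI: "GDERIV h x :> g \<Longrightarrow> gradient h x = g"
  unfolding gradient_def
proof (rule the_equality)
  fix g' assume "GDERIV h x :> g" "GDERIV h x :> g'"
  then have "(\<lambda>v. v \<bullet> g) = (\<lambda>v. v \<bullet> g')"
    unfolding gderiv_def by (rule has_derivative_unique)
  then show "g' = g" by (metis vector_eq_ldot)
qed

lemma gderiv_gradient:
  assumes "h differentiable (at x)"
  shows "GDERIV h x :> gradient h x"
proof -
  from assms obtain h' where h': "(h has_derivative h') (at x)"
    unfolding differentiable_def by blast
  then have lin: "linear h'" by (rule has_derivative_linear)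
  have "h' = (\<lambda>v. v \<bullet> adjoint h' 1)"
    using adjoint_works[OF lin, of _ 1] by (auto simp: fun_eq_iff)
  with h' have "GDERIV h x :> adjoint h' 1" unfolding gderiv_def by metis
  then show ?thesis by (simp add: gradient_eqI)
qed

abbreviation stoch_grad :: "('a::euclidean_space \<Rightarrow> 's \<Rightarrow> real) \<Rightarrow> 'a \<Rightarrow> 's \<Rightarrow> 'a" where
  "stoch_grad f x s \<equiv> gradient (\<lambda>y. f y s) x"

definition objective :: "'s measure \<Rightarrow> ('a::euclidean_space \<Rightarrow> 's \<Rightarrow> real) \<Rightarrow> 'a \<Rightarrow> real" where
  "objective D f x = (\<integral>s. f x s \<partial>D)"

definition optimal_value :: "'s measure \<Rightarrow> ('a::euclidean_space \<Rightarrow> 's \<Rightarrow> real) \<Rightarrow> real" where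
  "optimal_value D f = (INF x. objective D f x)"

text \<open>
  ``For every sample in the support of D'' is rendered as ``for D-almost every sample'',
  simultaneously for all points x, so that no topology on the sample space is needed.
  The assumptions integrable_f and measurable_grad only make the expectations
  meaningful: expectations are Bochner integrals, which are 0 for non-integrable functions.
  Together with bounded_grad they make all the integrands below integrable.
\<close>

locale stochastic_problem = prob_space D
  for D :: "'s measure" +
  fixes f :: "'a::euclidean_space \<Rightarrow> 's \<Rightarrow> real" and \<sigma> \<beta> G :: real
  assumes integrable_f: "\<And>x. integrable D (f x)"
    and measurable_grad: "(\<lambda>(x, s). stoch_grad f x s) \<in> borel_measurable (borel \<Otimes>\<^sub>M D)"
    and differentiable_f: "AE s in D. \<forall>x. (\<lambda>y. f y s) differentiable (at x)"
    and differentiable_objective: "\<And>x. objective D f differentiable (at x)"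
    and bounded_below: "bdd_below (range (objective D f))"
    and unbiased: "\<And>x. (\<integral>s. stoch_grad f x s \<partial>D) = gradient (objective D f) x"
    and variance_bound:
      "\<And>x. (\<integral>s. (norm (stoch_grad f x s - gradient (objective D f) x))\<^sup>2 \<partial>D) \<le> \<sigma>\<^sup>2"
    and averaged_smooth:
      "\<And>x y. (\<integral>s. (norm (stoch_grad f x s - stoch_grad f y s))\<^sup>2 \<partial>D)
               \<le> \<beta>\<^sup>2 * (norm (x - y))\<^sup>2"
    and bounded_grad: "AE s in D. \<forall>x. norm (stoch_grad f x s) \<le> G"

definition iid_samples :: "'w measure \<Rightarrow> 's measure \<Rightarrow> (nat \<Rightarrow> 'w \<Rightarrow> 's) \<Rightarrow> bool" where
  "iid_samples M D \<xi> \<longleftrightarrow>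
     prob_space M \<and>
     prob_space.indep_vars M (\<lambda>_. D) \<xi> {1..} \<and>
     (\<forall>t\<ge>1. distr M D (\<xi> t) = D)"

text \<open>
  The sequences x, d, a, b are the iterates of META-STORM-SG run for T iterations on the
  sample sequence s. Only the values x 1, ..., x (T + 1), d 1, ..., d (T + 1),
  a 2, ..., a (T + 1) and b 1, ..., b T are constrained.
\<close>

definition meta_storm_sg ::
  "real \<Rightarrow> real \<Rightarrow> real \<Rightarrow> real \<Rightarrow> real \<Rightarrow> ('a::euclidean_space \<Rightarrow> 's \<Rightarrow> real) \<Rightarrow> 'a \<Rightarrow> nat \<Rightarrow>
   (nat \<Rightarrow> 's) \<Rightarrow> (nat \<Rightarrow> 'a) \<Rightarrow> (nat \<Rightarrow> 'a) \<Rightarrow> (nat \<Rightarrow> real) \<Rightarrow> (nat \<Rightarrow> real) \<Rightarrow> bool" where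
  "meta_storm_sg a0 b0 \<eta> p q f x1 T s x d a b \<longleftrightarrow>
     x 1 = x1 \<and>
     d 1 = stoch_grad f x1 (s 1) \<and>
     (\<forall>t\<in>{1..T}.
        a (t + 1) =
          (1 + (\<Sum>i=1..t. (norm (stoch_grad f (x i) (s i)))\<^sup>2 / a0\<^sup>2)) powr (- 2 / 3) \<and>
        b t = (b0 powr (1 / p) + (\<Sum>i=1..t. (norm (d i))\<^sup>2)) powr p / a (t + 1) powr q \<and>
        x (t + 1) = x t - (\<eta> / b t) *\<^sub>R d t \<and>
        d (t + 1) = stoch_grad f (x (t + 1)) (s (t + 1)) +
          (1 - a (t + 1)) *\<^sub>R (d t - stoch_grad f (x t) (s (t + 1))))"

text \<open>
  The randomness of the output: the samples, together with an index that is uniform on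
  {1, ..., T} and independent of the samples.
\<close>

definition output_space :: "'w measure \<Rightarrow> nat \<Rightarrow> ('w \<times> nat) measure" where
  "output_space M T = M \<Otimes>\<^sub>M uniform_count_measure {1..T}"

text \<open>
  The logarithm of the smoothness constant occurs with a non-integer exponent, which is
  meaningful only when the logarithm is nonnegative. It is truncated at 0, so that the
  term vanishes for smoothness constants below 1.
\<close>

definition pos_ln :: "real \<Rightarrow> real" where
  "pos_ln u = max 0 (ln u)"

end

theory Submission
  imports Defs
begin

text \<open>
  Write r t for the cube root of S t = 1 + (sum of |g i|^2 / a0^2 over i <= t), y t for
  b0^(1/p) plus the sum of |d i|^2 over i <= t, and e t = d t - grad F (x t). Then
  a (t+1) = 1 / (r t)^2, and b t = (y t)^p (r t)^(1-p) is a weighted geometric mean of y t and r t.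

  Weighting the one-step recursion for E|e t|^2 by r t + R, where R = G^2 / a0^2 absorbs the
  increments of r, bounds P = E(sum of |e t|^2 / r t) by logarithms and by
  E(sum of r t |d t|^2 / (b t)^2). The descent lemma bounds Q = E(sum of |d t|^2 / b t) by P and
  logarithms. For every K > 0, r / b^2 <= K^(-p) / b + K^(1-2p) / y, so that choosing K as a
  large multiple of beta^(1/p) closes the loop: P = O(K ln T) and K^p Q = O(K ln T).

  Up to constants, the sum H of |grad F (x t)|^2 is at most r T times
  (Q' + const)^(1/(1-p)) + P', where P' and Q' are the sums in P and Q. Hence Hoelder's
  inequality bounds E(H^phat) by a power of E(S T). The crude bound S T = O(T) already gives E H = o(T), whence
  E(S T) = O(sigma^2 T) for large T; inserting this into the same bound yields the rate, since the
  terms that depend on F (x1) - F^* are of lower order in T.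
\<close>

section \<open>Inequalities\<close>

text \<open>\<open>C\<close> is fixed before \<open>\<beta>\<close>, \<open>\<sigma>\<close> and
  \<open>\<Delta>\<close>, while \<open>T0\<close> may depend on all three. This decides how terms
  are absorbed: every quantity is compared with \<open>K * ln T\<close>, where K is of order
  \<open>\<beta> powr (1 / p)\<close>. Terms with \<open>\<Delta>\<close> fit in for large T; terms
  without \<open>\<beta>\<close> fit in because \<open>\<beta> \<ge> \<beta>0\<close> keeps K away
  from 0; and ln T becomes the logarithm of the rate once
  \<open>\<sigma>^2 * sqrt T \<ge> 1\<close>. The weight r suits the exponent 2/3 of the algorithm:
  \<open>r * (1 - 1 / r^2) = r - 1 / r\<close> releases the error divided by r, and fresh gradient
  noise enters with factor \<open>r * (1 / r^2)^2 = 1 / S\<close>, so its sum is logarithmic. The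
  exponent phat is the one with phat / (1 - p) = 2/3. It leaves the products Q'^(2/3) S^(phat/3) and
  P'^phat S^(phat/3), whose total exponents are below 1, so that first moments suffice for Hoelder's
  inequality. The crude bound is enough because H is at most G^2 T on every path: H <= (G^2 T)^(1 -
  phat) H^phat, so E H is of order T^(1 - 2 phat / 3) up to logarithms. The circular inequalities
  for P and Q may be solved because all expectations are finite: each variable has an almost sure
  bound, possibly growing with T.\<close>

lemma power2_add_le:
  fixes u v :: real
  shows "(u + v)\<^sup>2 \<le> 2 * u\<^sup>2 + 2 * v\<^sup>2"
  using sum_squares_bound[of u v] by (simp add: power2_sum)

text \<open>Weighted AM-GM for the three numbers u, v and 1, the last one carrying the weight that
  is left over. The proof adds the tangent inequalities \<open>ln z \<le> z - 1\<close> for the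
  ratios to the weighted mean m, whose right-hand sides cancel.\<close>

lemma powr_mult_le_affine:
  fixes u v \<alpha> \<gamma> :: real
  assumes "u \<ge> 0" "v \<ge> 0" "\<alpha> \<ge> 0" "\<gamma> \<ge> 0" "\<alpha> + \<gamma> \<le> 1"
  shows "u powr \<alpha> * v powr \<gamma> \<le> \<alpha> * u + \<gamma> * v + (1 - \<alpha> - \<gamma>)"
proof (cases "u = 0 \<or> v = 0")
  \<comment> \<open>Since \<open>0 powr 0 = 0\<close>, the left-hand side vanishes even if the
    exponent is 0.\<close>
  case True
  with assms show ?thesis by auto
next
  case False
  with assms have uv: "u > 0" "v > 0" by auto
  define m where "m = \<alpha> * u + \<gamma> * v + (1 - \<alpha> - \<gamma>)"
  have m: "m > 0"
  proof (cases "\<alpha> = 0 \<and> \<gamma> = 0")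
    case False
    then have "\<alpha> * u > 0 \<or> \<gamma> * v > 0" using assms uv by auto
    moreover have "\<alpha> * u \<ge> 0" "\<gamma> * v \<ge> 0" using assms uv by auto
    ultimately show ?thesis using assms(5) unfolding m_def by linarith
  qed (simp add: m_def)
  have "\<alpha> * ln (u / m) \<le> \<alpha> * (u / m - 1)" "\<gamma> * ln (v / m) \<le> \<gamma> * (v / m - 1)"
    "(1 - \<alpha> - \<gamma>) * ln (1 / m) \<le> (1 - \<alpha> - \<gamma>) * (1 / m - 1)"
    using assms uv m by (auto intro!: mult_left_mono ln_le_minus_one)
  moreover have "\<alpha> * (u / m - 1) + \<gamma> * (v / m - 1) + (1 - \<alpha> - \<gamma>) * (1 / m - 1) = 0"
  proof -
    have "\<alpha> * (u / m - 1) + \<gamma> * (v / m - 1) + (1 - \<alpha> - \<gamma>) * (1 / m - 1)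
        = (\<alpha> * u + \<gamma> * v + (1 - \<alpha> - \<gamma>)) / m - 1"
      by (simp add: diff_divide_distrib add_divide_distrib algebra_simps)
    with m show ?thesis by (simp add: m_def[symmetric])
  qed
  ultimately have "\<alpha> * ln (u / m) + \<gamma> * ln (v / m) + (1 - \<alpha> - \<gamma>) * ln (1 / m) \<le> 0"
    by linarith
  then have "\<alpha> * ln u + \<gamma> * ln v \<le> ln m"
    using uv m by (simp add: ln_div algebra_simps)
  then have "exp (\<alpha> * ln u + \<gamma> * ln v) \<le> m"
    using m by (simp add: ln_ge_iff)
  then show ?thesis
    using uv by (simp add: powr_def exp_add m_def)
qed

text \<open>Hoelder's inequality with slack: the exponents may sum to less than 1 because the
  measure is a probability. Dividing by the upper bounds x and y and applying weighted AM-GM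
  pointwise gives an affine majorant, which also yields integrability.\<close>

lemma (in prob_space) expectation_powr_mult_le:
  fixes X Y :: "'a \<Rightarrow> real"
  assumes [measurable]: "integrable M X" "integrable M Y"
    and nn: "\<And>\<omega>. \<omega> \<in> space M \<Longrightarrow> X \<omega> \<ge> 0" "\<And>\<omega>. \<omega> \<in> space M \<Longrightarrow> Y \<omega> \<ge> 0"
    and le: "expectation X \<le> x" "expectation Y \<le> y" and pos: "x > 0" "y > 0"
    and e: "\<alpha> \<ge> 0" "\<gamma> \<ge> 0" "\<alpha> + \<gamma> \<le> 1"
  shows "integrable M (\<lambda>\<omega>. X \<omega> powr \<alpha> * Y \<omega> powr \<gamma>)"
    and "expectation (\<lambda>\<omega>. X \<omega> powr \<alpha> * Y \<omega> powr \<gamma>) \<le> x powr \<alpha> * y powr \<gamma>"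
proof -
  define Z where "Z = (\<lambda>\<omega>. \<alpha> * (X \<omega> / x) + \<gamma> * (Y \<omega> / y) + (1 - \<alpha> - \<gamma>))"
  have intZ: "integrable M Z"
    unfolding Z_def using assms(1,2) by auto
  have eq: "X \<omega> powr \<alpha> * Y \<omega> powr \<gamma>
      = (x powr \<alpha> * y powr \<gamma>) * ((X \<omega> / x) powr \<alpha> * (Y \<omega> / y) powr \<gamma>)"
    if "\<omega> \<in> space M" for \<omega>
    using that nn pos by (simp add: powr_divide)
  have ptw: "X \<omega> powr \<alpha> * Y \<omega> powr \<gamma> \<le> (x powr \<alpha> * y powr \<gamma>) * Z \<omega>"
    if "\<omega> \<in> space M" for \<omega>
    unfolding eq[OF that] Z_def using that nn pos e
    by (intro mult_left_mono powr_mult_le_affine) auto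
  show int: "integrable M (\<lambda>\<omega>. X \<omega> powr \<alpha> * Y \<omega> powr \<gamma>)"
  proof (rule Bochner_Integration.integrable_bound)
    show "integrable M (\<lambda>\<omega>. (x powr \<alpha> * y powr \<gamma>) * Z \<omega>)"
      using intZ by simp
    show "AE \<omega> in M. norm (X \<omega> powr \<alpha> * Y \<omega> powr \<gamma>) \<le> norm ((x powr \<alpha> * y powr \<gamma>) * Z \<omega>)"
    proof (rule AE_I2)
      fix \<omega> assume "\<omega> \<in> space M"
      from ptw[OF this] show "norm (X \<omega> powr \<alpha> * Y \<omega> powr \<gamma>) \<le> norm ((x powr \<alpha> * y powr \<gamma>) * Z \<omega>)"
        unfolding real_norm_def by (smt (verit) mult_nonneg_nonneg powr_ge_zero)
    qed
  qed measurable
  have "expectation (\<lambda>\<omega>. X \<omega> powr \<alpha> * Y \<omega> powr \<gamma>) \<le> (x powr \<alpha> * y powr \<gamma>) * expectation Z"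
    using integral_mono[OF int integrable_mult_right[OF intZ] ptw] by simp
  also have "\<dots> \<le> x powr \<alpha> * y powr \<gamma>"
  proof -
    have "expectation Z = \<alpha> * (expectation X / x) + \<gamma> * (expectation Y / y) + (1 - \<alpha> - \<gamma>)"
      unfolding Z_def using assms(1,2) by (simp add: prob_space)
    also have "\<dots> \<le> \<alpha> * 1 + \<gamma> * 1 + (1 - \<alpha> - \<gamma>)"
      using le pos e by (intro add_mono mult_left_mono) auto
    finally show ?thesis by (intro mult_left_le) auto
  qed
  finally show "expectation (\<lambda>\<omega>. X \<omega> powr \<alpha> * Y \<omega> powr \<gamma>) \<le> x powr \<alpha> * y powr \<gamma>" .
qed

text \<open>Bias-variance decomposition. With c = 0 it bounds both the variance and the squared norm
  of the mean by the second moment; with general c it removes the cross term from the error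
  recursion.\<close>

lemma (in prob_space) expectation_norm_diff_const_sq:
  fixes V :: "'a \<Rightarrow> 'b::euclidean_space"
  assumes "integrable M V" "integrable M (\<lambda>\<omega>. (norm (V \<omega>))\<^sup>2)"
  shows "expectation (\<lambda>\<omega>. (norm (V \<omega> - c))\<^sup>2)
    = expectation (\<lambda>\<omega>. (norm (V \<omega> - expectation V))\<^sup>2) + (norm (expectation V - c))\<^sup>2"
proof -
  have "expectation (\<lambda>\<omega>. (norm (V \<omega> - e))\<^sup>2)
      = expectation (\<lambda>\<omega>. (norm (V \<omega>))\<^sup>2) - 2 * (expectation V \<bullet> e) + (norm e)\<^sup>2" for e
  proof -
    have "(\<lambda>\<omega>. (norm (V \<omega> - e))\<^sup>2) = (\<lambda>\<omega>. (norm (V \<omega>))\<^sup>2 - 2 * (V \<omega> \<bullet> e) + (norm e)\<^sup>2)"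
      by (simp add: power2_norm_eq_inner inner_diff_left inner_diff_right inner_commute fun_eq_iff)
    then show ?thesis using assms by (simp add: prob_space)
  qed
  note E = this
  show ?thesis
    unfolding E by (simp add: power2_norm_eq_inner inner_diff_left inner_diff_right inner_commute)
qed

lemma lipschitz_gradient_upper_bound:
  fixes h :: "'a::euclidean_space \<Rightarrow> real"
  assumes der: "\<And>x. GDERIV h x :> g x"
    and lip: "\<And>x y. norm (g x - g y) \<le> L * norm (x - y)"
  shows "h y \<le> h x + g x \<bullet> (y - x) + L / 2 * (norm (y - x))\<^sup>2"
proof -
  define v where "v = y - x"
  \<comment> \<open>h along the segment minus the claimed majorant, up to the constant
    \<open>h x\<close>. The Lipschitz condition makes its derivative nonpositive for t >= 0.\<close>
  define \<phi> where "\<phi> = (\<lambda>t::real. h (x + t *\<^sub>R v) - t * (g x \<bullet> v) - L / 2 * t\<^sup>2 * (norm v)\<^sup>2)"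
  have "(\<phi> has_real_derivative (g (x + t *\<^sub>R v) \<bullet> v - g x \<bullet> v - L * t * (norm v)\<^sup>2)) (at t)" for t
  proof -
    have "((\<lambda>t. h (x + t *\<^sub>R v)) has_derivative (\<lambda>s. (s *\<^sub>R v) \<bullet> g (x + t *\<^sub>R v))) (at t)"
      using der[unfolded gderiv_def, of "x + t *\<^sub>R v"]
      by (intro has_derivative_compose[where g = h and f = "\<lambda>t. x + t *\<^sub>R v"])
         (auto intro!: derivative_eq_intros)
    then have "((\<lambda>t. h (x + t *\<^sub>R v)) has_real_derivative (g (x + t *\<^sub>R v) \<bullet> v)) (at t)"
      by (simp add: has_field_derivative_def inner_commute mult_commute_abs)
    then show ?thesis
      unfolding \<phi>_def by (auto intro!: derivative_eq_intros)
  qed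
  note D = this
  have "g (x + t *\<^sub>R v) \<bullet> v - g x \<bullet> v - L * t * (norm v)\<^sup>2 \<le> 0" if "t \<ge> 0" for t
  proof -
    have "g (x + t *\<^sub>R v) \<bullet> v - g x \<bullet> v = (g (x + t *\<^sub>R v) - g x) \<bullet> v"
      by (simp add: inner_diff_left)
    also have "\<dots> \<le> norm (g (x + t *\<^sub>R v) - g x) * norm v" by (rule norm_cauchy_schwarz)
    also have "\<dots> \<le> (L * norm (x + t *\<^sub>R v - x)) * norm v"
      by (intro mult_right_mono lip) auto
    also have "\<dots> = L * t * (norm v)\<^sup>2" using that by (simp add: power2_eq_square)
    finally show ?thesis by simp
  qed
  then have "\<phi> 1 \<le> \<phi> 0"
    using D by (intro DERIV_nonpos_imp_nonincreasing[of 0 1 \<phi>]) fastforce+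
  then show ?thesis by (simp add: \<phi>_def v_def)
qed

section \<open>One query of the gradient oracle: moments, smoothness, estimator error\<close>

context stochastic_problem
begin

abbreviation grad_obj :: "'a \<Rightarrow> 'a" where
  "grad_obj \<equiv> gradient (objective D f)"

lemma measurable_stoch_grad_comp:
  assumes [measurable]: "X \<in> borel_measurable N" "Y \<in> N \<rightarrow>\<^sub>M D"
  shows "(\<lambda>\<omega>. stoch_grad f (X \<omega>) (Y \<omega>)) \<in> borel_measurable N"
proof -
  have "(\<lambda>\<omega>. (\<lambda>(x, s). stoch_grad f x s) (X \<omega>, Y \<omega>)) \<in> borel_measurable N"
    by (rule measurable_compose[OF _ measurable_grad]) measurable
  then show ?thesis by simp
qed

lemma measurable_stoch_grad [measurable]: "stoch_grad f x \<in> borel_measurable D"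
  by (rule measurable_stoch_grad_comp) auto

lemma AE_norm_stoch_grad_le: "AE s in D. norm (stoch_grad f x s) \<le> G"
  using bounded_grad by eventually_elim auto

lemma integrable_stoch_grad [simp]: "integrable D (stoch_grad f x)"
  using AE_norm_stoch_grad_le by (rule integrable_const_bound) measurable

text \<open>The free coefficients let one almost sure bound serve single gradients, gradient
  differences and the damped differences of the estimator.\<close>

lemma integrable_norm_stoch_grad_comb_sq:
  "integrable D (\<lambda>s. (norm (u *\<^sub>R stoch_grad f x s - v *\<^sub>R stoch_grad f y s - c))\<^sup>2)"
proof (rule integrable_const_bound[where B = "(\<bar>u\<bar> * G + \<bar>v\<bar> * G + norm c)\<^sup>2"])
  show "AE s in D. norm ((norm (u *\<^sub>R stoch_grad f x s - v *\<^sub>R stoch_grad f y s - c))\<^sup>2)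
      \<le> (\<bar>u\<bar> * G + \<bar>v\<bar> * G + norm c)\<^sup>2"
    using AE_norm_stoch_grad_le[of x] AE_norm_stoch_grad_le[of y]
  proof eventually_elim
    case (elim s)
    have "norm (u *\<^sub>R stoch_grad f x s - v *\<^sub>R stoch_grad f y s - c)
      \<le> norm (u *\<^sub>R stoch_grad f x s) + norm (v *\<^sub>R stoch_grad f y s) + norm c"
      by (rule order.trans[OF norm_triangle_ineq4 add_right_mono[OF norm_triangle_ineq4]])
    also have "\<dots> \<le> \<bar>u\<bar> * G + \<bar>v\<bar> * G + norm c"
      using elim by (auto intro!: add_mono mult_left_mono)
    finally show ?case by (simp add: power_mono)
  qed
qed measurable

lemmas integrable_norm_stoch_grad_sq [simp] =
  integrable_norm_stoch_grad_comb_sq[of 1 _ 0 _ 0, simplified]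
lemmas integrable_norm_stoch_grad_diff_sq [simp] =
  integrable_norm_stoch_grad_comb_sq[of 1 _ 1 _ 0, simplified]

lemma second_moment_stoch_grad_le:
  "(\<integral>s. (norm (stoch_grad f x s))\<^sup>2 \<partial>D) \<le> \<sigma>\<^sup>2 + (norm (grad_obj x))\<^sup>2"
  using expectation_norm_diff_const_sq[of "stoch_grad f x" 0] variance_bound[of x]
  by (simp add: unbiased)

lemma norm_grad_obj_le: "norm (grad_obj x) \<le> G"
proof -
  have "norm (grad_obj x) \<le> (\<integral>s. norm (stoch_grad f x s) \<partial>D)"
    unfolding unbiased[symmetric] by (rule integral_norm_bound)
  also have "\<dots> \<le> (\<integral>s. G \<partial>D)"
    using AE_norm_stoch_grad_le by (intro integral_mono_AE) auto
  finally show ?thesis by (simp add: prob_space)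
qed

text \<open>Jensen's inequality transfers the averaged smoothness of the samples to the gradient of
  the objective.\<close>

lemma norm_grad_obj_diff_le:
  assumes "\<beta> \<ge> 0"
  shows "norm (grad_obj x - grad_obj y) \<le> \<beta> * norm (x - y)"
proof -
  let ?W = "\<lambda>s. stoch_grad f x s - stoch_grad f y s"
  have "(norm (expectation ?W))\<^sup>2 \<le> expectation (\<lambda>s. (norm (?W s))\<^sup>2)"
    using expectation_norm_diff_const_sq[of ?W 0] by simp
  also have "\<dots> \<le> \<beta>\<^sup>2 * (norm (x - y))\<^sup>2" by (rule averaged_smooth)
  finally have "(norm (grad_obj x - grad_obj y))\<^sup>2 \<le> (\<beta> * norm (x - y))\<^sup>2"
    by (simp add: unbiased power_mult_distrib)
  then show ?thesis using assms by (simp add: power2_le_iff_abs_le)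
qed

lemma measurable_grad_obj [measurable]: "grad_obj \<in> borel_measurable borel"
proof -
  have "(\<lambda>x. \<integral>s. (\<lambda>(x, s). stoch_grad f x s) (x, s) \<partial>D) \<in> borel_measurable borel"
    using measurable_grad by (intro borel_measurable_lebesgue_integral) simp
  then show ?thesis by (simp add: unbiased)
qed

lemma objective_descent:
  assumes "\<beta> \<ge> 0"
  shows "objective D f y \<le> objective D f x + grad_obj x \<bullet> (y - x) + \<beta> / 2 * (norm (y - x))\<^sup>2"
  by (rule lipschitz_gradient_upper_bound[OF gderiv_gradient[OF differentiable_objective]])
     (rule norm_grad_obj_diff_le[OF assms])

text \<open>Here \<open>e\<close> is the previous direction, \<open>x\<close> the previous point and
  \<open>x'\<close> the new one; only the sample is random. The bias of the new direction is
  \<open>(1 - c)\<close> times the old error, and its noise is \<open>(1 - c)\<close> times the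
  centred gradient difference plus c times the centred gradient at \<open>x'\<close>. Smoothness
  controls the former. The latter is bounded by the second moment, since squared gradients are what
  \<open>S\<close> accumulates.\<close>

lemma expected_estimator_error_le:
  assumes c: "0 \<le> c" "c \<le> 1"
  shows "(\<integral>s. (norm (stoch_grad f x' s + (1 - c) *\<^sub>R (e - stoch_grad f x s) - grad_obj x'))\<^sup>2 \<partial>D)
    \<le> (1 - c) * (norm (e - grad_obj x))\<^sup>2 + 2 * (\<beta>\<^sup>2 * (norm (x' - x))\<^sup>2)
      + 2 * c\<^sup>2 * (\<integral>s. (norm (stoch_grad f x' s))\<^sup>2 \<partial>D)"
proof -
  define V where "V = (\<lambda>s. stoch_grad f x' s - (1 - c) *\<^sub>R stoch_grad f x s)"
  define W where "W = (\<lambda>s. stoch_grad f x' s - stoch_grad f x s)"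
  define N where "N = stoch_grad f x'"
  have fold_N: "(\<integral>s. (norm (stoch_grad f x' s))\<^sup>2 \<partial>D) = expectation (\<lambda>s. (norm (N s))\<^sup>2)"
    by (simp add: N_def)
  have EV: "expectation V = grad_obj x' - (1 - c) *\<^sub>R grad_obj x"
    unfolding V_def by (simp add: unbiased)
  have EW: "expectation W = grad_obj x' - grad_obj x"
    unfolding W_def by (simp add: unbiased)
  have EN: "expectation N = grad_obj x'"
    unfolding N_def by (simp add: unbiased)
  have iV: "integrable D V" "integrable D (\<lambda>s. (norm (V s))\<^sup>2)"
      "integrable D (\<lambda>s. (norm (V s - expectation V))\<^sup>2)"
    using integrable_norm_stoch_grad_comb_sq[of 1 x' "1 - c" x] 
      integrable_norm_stoch_grad_comb_sq[of 1 x' "1 - c" x 0] by (auto simp: V_def)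
  have iW: "integrable D W" "integrable D (\<lambda>s. (norm (W s))\<^sup>2)"
      "integrable D (\<lambda>s. (norm (W s - expectation W))\<^sup>2)"
    using integrable_norm_stoch_grad_comb_sq[of 1 x' 1 x] by (auto simp: W_def)
  have iN: "integrable D N" "integrable D (\<lambda>s. (norm (N s))\<^sup>2)"
      "integrable D (\<lambda>s. (norm (N s - expectation N))\<^sup>2)"
    using integrable_norm_stoch_grad_comb_sq[of 1 x' 0 x] by (auto simp: N_def)
  have ptw: "(norm (V s - expectation V))\<^sup>2
      \<le> 2 * (norm (W s - expectation W))\<^sup>2 + 2 * c\<^sup>2 * (norm (N s - expectation N))\<^sup>2" for s
  proof -
    have "V s - expectation V = (1 - c) *\<^sub>R (W s - expectation W) + c *\<^sub>R (N s - expectation N)"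
      unfolding EV EW EN V_def W_def N_def by (simp add: algebra_simps)
    then have "norm (V s - expectation V)
        \<le> (1 - c) * norm (W s - expectation W) + c * norm (N s - expectation N)"
      using norm_triangle_ineq[of "(1 - c) *\<^sub>R (W s - expectation W)" "c *\<^sub>R (N s - expectation N)"] c
      by simp
    also have "\<dots> \<le> 1 * norm (W s - expectation W) + c * norm (N s - expectation N)"
      using c by (intro add_mono mult_right_mono) auto
    finally have "(norm (V s - expectation V))\<^sup>2
        \<le> (norm (W s - expectation W) + c * norm (N s - expectation N))\<^sup>2"
      by (simp add: power_mono)
    also have "\<dots> \<le> 2 * (norm (W s - expectation W))\<^sup>2 + 2 * (c * norm (N s - expectation N))\<^sup>2"
      by (rule power2_add_le)
    finally show ?thesis by (simp add: power_mult_distrib)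
  qed
  have "(\<integral>s. (norm (stoch_grad f x' s + (1 - c) *\<^sub>R (e - stoch_grad f x s) - grad_obj x'))\<^sup>2 \<partial>D)
      = (\<integral>s. (norm (V s - (grad_obj x' - (1 - c) *\<^sub>R e)))\<^sup>2 \<partial>D)"
    unfolding V_def by (simp add: algebra_simps)
  also have "\<dots> = (\<integral>s. (norm (V s - expectation V))\<^sup>2 \<partial>D) + (norm ((1 - c) *\<^sub>R (e - grad_obj x)))\<^sup>2"
    by (subst expectation_norm_diff_const_sq[OF iV(1,2)]) (simp add: EV algebra_simps)
  finally have eq: "(\<integral>s. (norm (stoch_grad f x' s + (1 - c) *\<^sub>R (e - stoch_grad f x s) - grad_obj x'))\<^sup>2 \<partial>D)
      = (\<integral>s. (norm (V s - expectation V))\<^sup>2 \<partial>D) + (norm ((1 - c) *\<^sub>R (e - grad_obj x)))\<^sup>2" .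
  have V_le: "(\<integral>s. (norm (V s - expectation V))\<^sup>2 \<partial>D)
      \<le> 2 * expectation (\<lambda>s. (norm (W s - expectation W))\<^sup>2)
        + 2 * c\<^sup>2 * expectation (\<lambda>s. (norm (N s - expectation N))\<^sup>2)"
    using integral_mono[OF iV(3) _ ptw] iW(3) iN(3) by simp
  have W_le: "expectation (\<lambda>s. (norm (W s - expectation W))\<^sup>2) \<le> \<beta>\<^sup>2 * (norm (x' - x))\<^sup>2"
  proof -
    have "expectation (\<lambda>s. (norm (W s))\<^sup>2) \<le> \<beta>\<^sup>2 * (norm (x' - x))\<^sup>2"
      using averaged_smooth[of x' x] by (simp add: W_def)
    moreover have "expectation (\<lambda>s. (norm (W s - expectation W))\<^sup>2) \<le> expectation (\<lambda>s. (norm (W s))\<^sup>2)"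
      using expectation_norm_diff_const_sq[OF iW(1,2), of 0] zero_le_power2[of "norm (expectation W - 0)"]
      unfolding diff_0_right by linarith
    ultimately show ?thesis by linarith
  qed
  have N_le: "expectation (\<lambda>s. (norm (N s - expectation N))\<^sup>2) \<le> (\<integral>s. (norm (stoch_grad f x' s))\<^sup>2 \<partial>D)"
    using expectation_norm_diff_const_sq[OF iN(1,2), of 0] zero_le_power2[of "norm (expectation N - 0)"]
    unfolding diff_0_right fold_N by linarith
  have e_le: "(norm ((1 - c) *\<^sub>R (e - grad_obj x)))\<^sup>2 \<le> (1 - c) * (norm (e - grad_obj x))\<^sup>2"
  proof -
    have "(1 - c)\<^sup>2 \<le> 1 - c" using c by (simp add: power2_eq_square mult_left_le)
    then show ?thesis by (simp add: power_mult_distrib mult_right_mono)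
  qed
  have "2 * c\<^sup>2 * expectation (\<lambda>s. (norm (N s - expectation N))\<^sup>2)
      \<le> 2 * c\<^sup>2 * (\<integral>s. (norm (stoch_grad f x' s))\<^sup>2 \<partial>D)"
    using N_le by (intro mult_left_mono) auto
  with eq V_le W_le e_le show ?thesis by linarith
qed

end

section \<open>Independent samples\<close>

definition AE_bounded :: "'w measure \<Rightarrow> ('w \<Rightarrow> 'b::real_normed_vector) \<Rightarrow> bool" where
  "AE_bounded M X \<longleftrightarrow> (\<exists>C. AE \<omega> in M. norm (X \<omega>) \<le> C)"

lemma AE_boundedI: "(AE \<omega> in M. norm (X \<omega>) \<le> C) \<Longrightarrow> AE_bounded M X"
  by (auto simp: AE_bounded_def)

lemma AE_bounded_const: "AE_bounded M (\<lambda>_. c)"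
  by (rule AE_boundedI[where C = "norm c"]) auto

lemma AE_bounded_norm: "AE_bounded M X \<Longrightarrow> AE_bounded M (\<lambda>\<omega>. norm (X \<omega>))"
  by (auto simp: AE_bounded_def)

lemma AE_bounded_add:
  assumes "AE_bounded M X" "AE_bounded M Y"
  shows "AE_bounded M (\<lambda>\<omega>. X \<omega> + Y \<omega>)"
proof -
  from assms obtain A B where "AE \<omega> in M. norm (X \<omega>) \<le> A" "AE \<omega> in M. norm (Y \<omega>) \<le> B"
    unfolding AE_bounded_def by blast
  then have "AE \<omega> in M. norm (X \<omega> + Y \<omega>) \<le> A + B"
    by eventually_elim (rule norm_triangle_mono)
  then show ?thesis by (rule AE_boundedI)
qed

lemma AE_bounded_scaleR:
  assumes "AE_bounded M X" "AE_bounded M Y"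
  shows "AE_bounded M (\<lambda>\<omega>. X \<omega> *\<^sub>R Y \<omega>)"
proof -
  from assms obtain A B where "AE \<omega> in M. norm (X \<omega>) \<le> A" "AE \<omega> in M. norm (Y \<omega>) \<le> B"
    unfolding AE_bounded_def by blast
  then have "AE \<omega> in M. norm (X \<omega> *\<^sub>R Y \<omega>) \<le> A * B"
    by eventually_elim (use order.trans[OF norm_ge_zero] in \<open>auto intro!: mult_mono\<close>)
  then show ?thesis by (rule AE_boundedI)
qed

lemma AE_bounded_uminus: "AE_bounded M X \<Longrightarrow> AE_bounded M (\<lambda>\<omega>. - X \<omega>)"
  by (auto simp: AE_bounded_def)

lemma AE_bounded_diff:
  assumes "AE_bounded M X" "AE_bounded M Y"
  shows "AE_bounded M (\<lambda>\<omega>. X \<omega> - Y \<omega>)"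
  using AE_bounded_add[OF assms(1) AE_bounded_uminus[OF assms(2)]] by simp

lemma AE_bounded_mult:
  fixes X Y :: "'w \<Rightarrow> real"
  assumes "AE_bounded M X" "AE_bounded M Y"
  shows "AE_bounded M (\<lambda>\<omega>. X \<omega> * Y \<omega>)"
  using AE_bounded_scaleR[OF assms] by simp

lemma AE_bounded_power2:
  fixes X :: "'w \<Rightarrow> real"
  shows "AE_bounded M X \<Longrightarrow> AE_bounded M (\<lambda>\<omega>. (X \<omega>)\<^sup>2)"
  unfolding power2_eq_square by (rule AE_bounded_mult)

lemma AE_bounded_divide:
  fixes X Y :: "'w \<Rightarrow> real"
  assumes "AE_bounded M X" "AE_bounded M (\<lambda>\<omega>. 1 / Y \<omega>)"
  shows "AE_bounded M (\<lambda>\<omega>. X \<omega> / Y \<omega>)"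
  using AE_bounded_mult[OF assms] by simp

lemmas AE_bounded_intros = AE_bounded_const AE_bounded_norm AE_bounded_add AE_bounded_scaleR
  AE_bounded_uminus AE_bounded_diff AE_bounded_mult AE_bounded_power2

text \<open>The purpose of the closure rules above: for integrability the value of the bound is
  irrelevant, so it is hidden in an existential quantifier.\<close>

lemma (in prob_space) integrable_AE_bounded:
  fixes X :: "'a \<Rightarrow> 'b::euclidean_space"
  assumes "AE_bounded M X" "X \<in> borel_measurable M"
  shows "integrable M X"
  using assms integrable_const_bound unfolding AE_bounded_def by blast

text \<open>The natural filtration of the samples. Pulling it back from a product space presents
  each event as a preimage under the tuple of the first n samples, the form in which independence of
  the next sample can be used.\<close>

definition sample_algebra :: "'w measure \<Rightarrow> 's measure \<Rightarrow> (nat \<Rightarrow> 'w \<Rightarrow> 's) \<Rightarrow> nat \<Rightarrow> 'w measure" where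
  "sample_algebra M D \<xi> n =
     vimage_algebra (space M) (\<lambda>\<omega>. \<lambda>i\<in>{1..n}. \<xi> i \<omega>) (\<Pi>\<^sub>M i\<in>{1..n}. D)"

lemma space_sample_algebra [simp]: "space (sample_algebra M D \<xi> n) = space M"
  by (simp add: sample_algebra_def)

lemma (in prob_space) measurable_sample_algebra:
  fixes D :: "'s measure"
  assumes "\<And>i. i \<in> {1..n} \<Longrightarrow> \<xi> i \<in> M \<rightarrow>\<^sub>M D" and i: "i \<in> {1..n}"
  shows "\<xi> i \<in> sample_algebra M D \<xi> n \<rightarrow>\<^sub>M D"
proof -
  let ?Y = "\<lambda>\<omega>. \<lambda>i\<in>{1..n}. \<xi> i \<omega>"
  have "?Y \<in> M \<rightarrow>\<^sub>M (\<Pi>\<^sub>M i\<in>{1..n}. D)"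
    using assms by (intro measurable_restrict) auto
  then have "?Y \<in> sample_algebra M D \<xi> n \<rightarrow>\<^sub>M (\<Pi>\<^sub>M i\<in>{1..n}. D)"
    unfolding sample_algebra_def by (intro measurable_vimage_algebra1) (auto dest: measurable_space)
  then have "(\<lambda>\<omega>. ?Y \<omega> i) \<in> sample_algebra M D \<xi> n \<rightarrow>\<^sub>M D"
    by (rule measurable_compose[OF _ measurable_component_singleton[OF i]])
  then show ?thesis using i by simp
qed

text \<open>Past and next sample are independent: the pair of \<open>\<omega>\<close>, seen only
  through the first n samples, and the next sample has a product law. By sigma-finiteness it is
  enough to compare rectangles.\<close>

lemma (in prob_space) distr_sample_algebra_pair:
  fixes D :: "'s measure"
  assumes ind: "indep_vars (\<lambda>_. D) \<xi> {1..}"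
  shows "(\<lambda>\<omega>. \<omega>) \<in> M \<rightarrow>\<^sub>M sample_algebra M D \<xi> n" (is ?m)
    and "distr M (sample_algebra M D \<xi> n) (\<lambda>\<omega>. \<omega>) \<Otimes>\<^sub>M distr M D (\<xi> (Suc n))
      = distr M (sample_algebra M D \<xi> n \<Otimes>\<^sub>M D) (\<lambda>\<omega>. (\<omega>, \<xi> (Suc n) \<omega>))" (is "?L = ?R")
proof -
  let ?Y = "\<lambda>\<omega>. \<lambda>i\<in>{1..n}. \<xi> i \<omega>" and ?P = "\<Pi>\<^sub>M i\<in>{1..n}. D"
  let ?Z = "\<lambda>\<omega>. \<lambda>i\<in>{Suc n}. \<xi> i \<omega>" and ?Q = "\<Pi>\<^sub>M i\<in>{Suc n}. D"
  let ?F = "sample_algebra M D \<xi> n"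
  have Y: "indep_var ?P ?Y ?Q ?Z"
    by (rule indep_var_restrict[OF ind]) auto
  then have mY: "?Y \<in> M \<rightarrow>\<^sub>M ?P" by (rule indep_var_rv1)
  have [measurable]: "\<xi> (Suc n) \<in> M \<rightarrow>\<^sub>M D"
    using ind by (auto simp: indep_vars_def)
  have sets: "sets ?F = {?Y -` A \<inter> space M | A. A \<in> sets ?P}"
    unfolding sample_algebra_def using measurable_space[OF mY]
    by (intro sets_vimage_algebra2) auto
  show m [measurable]: ?m
  proof (rule measurableI)
    fix A assume "A \<in> sets ?F"
    then obtain A' where "A = ?Y -` A' \<inter> space M" "A' \<in> sets ?P" using sets by auto
    then have "A \<in> sets M" using measurable_sets[OF mY] by auto
    then show "(\<lambda>\<omega>. \<omega>) -` A \<inter> space M \<in> sets M" by (simp add: vimage_def)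
  qed simp
  show "?L = ?R"
  proof (rule pair_measure_eqI)
    show "sigma_finite_measure (distr M ?F (\<lambda>\<omega>. \<omega>))" "sigma_finite_measure (distr M D (\<xi> (Suc n)))"
      by (auto intro!: prob_space_imp_sigma_finite prob_space_distr)
    fix A B
    assume A: "A \<in> sets (distr M ?F (\<lambda>\<omega>. \<omega>))" and B: "B \<in> sets (distr M D (\<xi> (Suc n)))"
    from A obtain A' where A': "A = ?Y -` A' \<inter> space M" "A' \<in> sets ?P" using sets by auto
    \<comment> \<open>\<open>indep_var_restrict\<close> speaks of tuples, so B is lifted to tuples
      with the single index \<open>Suc n\<close>.\<close>
    define B' where "B' = (\<lambda>z. z (Suc n)) -` B \<inter> space ?Q"
    have B': "B' \<in> sets ?Q"
      unfolding B'_def using B by (intro measurable_sets[OF measurable_component_singleton]) auto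
    have Zsp: "?Z \<omega> \<in> space ?Q" if "\<omega> \<in> space M" for \<omega>
      using measurable_space[OF indep_var_rv2[OF Y] that] .
    have ZB: "?Z -` B' \<inter> space M = \<xi> (Suc n) -` B \<inter> space M"
      using Zsp by (auto simp: B'_def)
    have "(\<lambda>\<omega>. (?Y \<omega>, ?Z \<omega>)) -` (A' \<times> B') \<inter> space M
        = (?Y -` A' \<inter> space M) \<inter> (?Z -` B' \<inter> space M)"
      by auto
    then have eq: "prob (A \<inter> (\<xi> (Suc n) -` B \<inter> space M)) = prob A * prob (\<xi> (Suc n) -` B \<inter> space M)"
      using indep_varD[OF Y A'(2) B'] unfolding ZB A'(1)[symmetric] by simp
    have AM: "(\<lambda>\<omega>. \<omega>) -` A \<inter> space M = A" using A' by auto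
    have "(\<lambda>\<omega>. (\<omega>, \<xi> (Suc n) \<omega>)) -` (A \<times> B) \<inter> space M = A \<inter> (\<xi> (Suc n) -` B \<inter> space M)"
      by auto
    then show "emeasure (distr M ?F (\<lambda>\<omega>. \<omega>)) A * emeasure (distr M D (\<xi> (Suc n))) B = emeasure ?R (A \<times> B)"
      using A B eq AM by (simp add: emeasure_distr emeasure_eq_measure ennreal_mult[symmetric])
  qed simp
qed

text \<open>Freezing: by the product law and Fubini, the next sample can be integrated out while the
  past is held fixed. This replaces conditioning on the past.\<close>

lemma (in prob_space) sample_algebra_expectation:
  fixes D :: "'s measure" and h :: "'a \<times> 's \<Rightarrow> real"
  assumes ind: "indep_vars (\<lambda>_. D) \<xi> {1..}" and D: "distr M D (\<xi> (Suc n)) = D"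
    and h [measurable]: "h \<in> borel_measurable (sample_algebra M D \<xi> n \<Otimes>\<^sub>M D)"
    and int: "integrable M (\<lambda>\<omega>. h (\<omega>, \<xi> (Suc n) \<omega>))"
  shows "integrable M (\<lambda>\<omega>. \<integral>s. h (\<omega>, s) \<partial>D)"
    and "expectation (\<lambda>\<omega>. h (\<omega>, \<xi> (Suc n) \<omega>)) = expectation (\<lambda>\<omega>. \<integral>s. h (\<omega>, s) \<partial>D)"
proof -
  let ?F = "sample_algebra M D \<xi> n"
  note [measurable] = distr_sample_algebra_pair(1)[OF ind, of n]
  note eq = distr_sample_algebra_pair(2)[OF ind, of n, unfolded D]
  have [measurable]: "\<xi> (Suc n) \<in> M \<rightarrow>\<^sub>M D"
    using ind by (auto simp: indep_vars_def)
  interpret F: prob_space "distr M ?F (\<lambda>\<omega>. \<omega>)" by (rule prob_space_distr) measurable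
  interpret D: prob_space D by (subst D[symmetric]) (rule prob_space_distr, measurable)
  interpret FD: pair_prob_space "distr M ?F (\<lambda>\<omega>. \<omega>)" D ..
  have intp: "integrable (distr M ?F (\<lambda>\<omega>. \<omega>) \<Otimes>\<^sub>M D) h"
    unfolding eq using int by (subst integrable_distr_eq) auto
  have m: "(\<lambda>\<omega>. \<integral>s. h (\<omega>, s) \<partial>D) \<in> borel_measurable ?F"
    using borel_measurable_integrable[OF FD.integrable_fst'[OF intp]] by simp
  show "integrable M (\<lambda>\<omega>. \<integral>s. h (\<omega>, s) \<partial>D)"
    using FD.integrable_fst'[OF intp] m by (subst (asm) integrable_distr_eq) auto
  have "expectation (\<lambda>\<omega>. h (\<omega>, \<xi> (Suc n) \<omega>)) = integral\<^sup>L (distr M ?F (\<lambda>\<omega>. \<omega>) \<Otimes>\<^sub>M D) h"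
    unfolding eq by (subst integral_distr) auto
  also have "\<dots> = (\<integral>\<omega>. (\<integral>s. h (\<omega>, s) \<partial>D) \<partial>distr M ?F (\<lambda>\<omega>. \<omega>))"
    by (rule FD.integral_fst'[OF intp, symmetric])
  also have "\<dots> = expectation (\<lambda>\<omega>. \<integral>s. h (\<omega>, s) \<partial>D)"
    using m by (subst integral_distr) auto
  finally show "expectation (\<lambda>\<omega>. h (\<omega>, \<xi> (Suc n) \<omega>)) = expectation (\<lambda>\<omega>. \<integral>s. h (\<omega>, s) \<partial>D)" .
qed

section \<open>Runs of the algorithm\<close>

locale storm_run = stochastic_problem D f \<sigma> \<beta> G + M: prob_space M
  for D :: "'s measure" and f :: "'a::euclidean_space \<Rightarrow> 's \<Rightarrow> real" and \<sigma> \<beta> G :: real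
    and M :: "'w measure" +
  fixes \<xi> :: "nat \<Rightarrow> 'w \<Rightarrow> 's" and a0 b0 \<eta> p q :: real and x1 :: 'a and T :: nat
    and x d :: "nat \<Rightarrow> 'w \<Rightarrow> 'a" and a b :: "nat \<Rightarrow> 'w \<Rightarrow> real"
  assumes iid: "iid_samples M D \<xi>"
    and run: "\<And>\<omega>. \<omega> \<in> space M \<Longrightarrow> meta_storm_sg a0 b0 \<eta> p q f x1 T (\<lambda>t. \<xi> t \<omega>)
         (\<lambda>t. x t \<omega>) (\<lambda>t. d t \<omega>) (\<lambda>t. a t \<omega>) (\<lambda>t. b t \<omega>)"
    and a0: "a0 > 0" and b0: "b0 > 0" and \<eta>: "\<eta> > 0"
    and p: "0 < p" "p \<le> 1 / 2" and q: "p + 2 * q = 1"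
    and G: "G \<ge> 0" and \<beta>: "\<beta> > 0"
begin

definition g :: "nat \<Rightarrow> 'w \<Rightarrow> 'a" where "g t \<omega> = stoch_grad f (x t \<omega>) (\<xi> t \<omega>)"
definition S :: "nat \<Rightarrow> 'w \<Rightarrow> real" where "S t \<omega> = 1 + (\<Sum>i=1..t. (norm (g i \<omega>))\<^sup>2 / a0\<^sup>2)"
definition r :: "nat \<Rightarrow> 'w \<Rightarrow> real" where "r t \<omega> = S t \<omega> powr (1 / 3)"
definition y :: "nat \<Rightarrow> 'w \<Rightarrow> real" where "y t \<omega> = b0 powr (1 / p) + (\<Sum>i=1..t. (norm (d i \<omega>))\<^sup>2)"
definition e :: "nat \<Rightarrow> 'w \<Rightarrow> 'a" where "e t \<omega> = d t \<omega> - grad_obj (x t \<omega>)"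
definition R :: real where "R = G\<^sup>2 / a0\<^sup>2"

lemma R_nonneg: "R \<ge> 0" by (simp add: R_def)

lemma S_ge_1: "S t \<omega> \<ge> 1"
  by (simp add: S_def sum_nonneg)

lemma S_Suc: "S (Suc t) \<omega> = S t \<omega> + (norm (g (Suc t) \<omega>))\<^sup>2 / a0\<^sup>2"
  by (simp add: S_def)

lemma S_mono: "S t \<omega> \<le> S (Suc t) \<omega>"
  by (simp add: S_Suc)

lemma r_ge_1: "r t \<omega> \<ge> 1"
  using S_ge_1[of t \<omega>] by (simp add: r_def ge_one_powr_ge_zero)

lemma r_pow3: "r t \<omega> ^ 3 = S t \<omega>"
  using S_ge_1[of t \<omega>] by (simp add: r_def powr_power)

lemma r_mono: "r t \<omega> \<le> r (Suc t) \<omega>"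
  using S_ge_1[of t \<omega>] S_mono by (simp add: r_def powr_mono2)

lemma r_mono_le: "s \<le> t \<Longrightarrow> r s \<omega> \<le> r t \<omega>"
  using lift_Suc_mono_le[of "\<lambda>t. r t \<omega>"] r_mono by blast

lemma y_pos: "y t \<omega> > 0"
  using b0 by (simp add: y_def add_pos_nonneg sum_nonneg)

lemma y_Suc: "y (Suc t) \<omega> = y t \<omega> + (norm (d (Suc t) \<omega>))\<^sup>2"
  by (simp add: y_def)

lemma y_mono_le: "s \<le> t \<Longrightarrow> y s \<omega> \<le> y t \<omega>"
  using lift_Suc_mono_le[of "\<lambda>t. y t \<omega>"] y_Suc by simp

lemma y_ge: "y t \<omega> \<ge> b0 powr (1 / p)"
  by (simp add: y_def sum_nonneg)

context
  fixes \<omega> assumes \<omega>: "\<omega> \<in> space M"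
begin

lemma x_1: "x 1 \<omega> = x1"
  using run[OF \<omega>] by (simp add: meta_storm_sg_def)

lemma d_1: "d 1 \<omega> = g 1 \<omega>"
  using run[OF \<omega>] by (simp add: meta_storm_sg_def g_def)

lemma a_Suc:
  assumes "t \<in> {1..T}"
  shows "a (Suc t) \<omega> = 1 / (r t \<omega>)\<^sup>2"
proof -
  have "a (Suc t) \<omega> = S t \<omega> powr (- 2 / 3)"
    using run[OF \<omega>] assms by (simp add: meta_storm_sg_def S_def g_def)
  also have "\<dots> = 1 / (S t \<omega> powr (2 / 3))"
    by (simp add: powr_minus_divide)
  also have "S t \<omega> powr (2 / 3) = (r t \<omega>)\<^sup>2"
    using S_ge_1[of t \<omega>] by (simp add: r_def powr_power)
  finally show ?thesis .
qed

lemma b_eq: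
  assumes "t \<in> {1..T}"
  shows "b t \<omega> = y t \<omega> powr p * r t \<omega> powr (1 - p)"
proof -
  have r: "r t \<omega> > 0" using r_ge_1[of t \<omega>] by simp
  have "b t \<omega> = y t \<omega> powr p / a (Suc t) \<omega> powr q"
    using run[OF \<omega>] assms by (simp add: meta_storm_sg_def y_def)
  also have "a (Suc t) \<omega> = r t \<omega> powr (- 2)"
    using r assms by (simp add: a_Suc powr_minus_divide)
  also have "(r t \<omega> powr (- 2)) powr q = r t \<omega> powr (- (1 - p))"
  proof -
    have "- 2 * q = - (1 - p)" using q by simp
    then show ?thesis by (simp only: powr_powr)
  qed
  finally show ?thesis unfolding powr_minus by (simp add: divide_inverse)
qed

lemma x_Suc: "t \<in> {1..T} \<Longrightarrow> x (Suc t) \<omega> = x t \<omega> - (\<eta> / b t \<omega>) *\<^sub>R d t \<omega>"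
  using run[OF \<omega>] by (simp add: meta_storm_sg_def)

lemma d_Suc:
  "t \<in> {1..T} \<Longrightarrow> d (Suc t) \<omega> = stoch_grad f (x (Suc t) \<omega>) (\<xi> (Suc t) \<omega>) +
    (1 - 1 / (r t \<omega>)\<^sup>2) *\<^sub>R (d t \<omega> - stoch_grad f (x t \<omega>) (\<xi> (Suc t) \<omega>))"
  using run[OF \<omega>] a_Suc[of t] by (simp add: meta_storm_sg_def)

lemma b_ge:
  assumes "t \<in> {1..T}"
  shows "b t \<omega> \<ge> b0"
proof -
  have "b0 * 1 \<le> y t \<omega> powr p * r t \<omega> powr (1 - p)"
  proof (rule mult_mono)
    have "(b0 powr (1 / p)) powr p \<le> y t \<omega> powr p"
      using y_ge[of t \<omega>] p by (intro powr_mono2) auto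
    then show "b0 \<le> y t \<omega> powr p" using p b0 by (simp add: powr_powr)
    show "1 \<le> r t \<omega> powr (1 - p)" using r_ge_1[of t \<omega>] p by (simp add: ge_one_powr_ge_zero)
  qed (use b0 in auto)
  then show ?thesis using b_eq[OF assms] by simp
qed

lemma b_mono:
  assumes "s \<le> t" "s \<in> {1..T}" "t \<in> {1..T}"
  shows "b s \<omega> \<le> b t \<omega>"
  unfolding b_eq[OF assms(2)] b_eq[OF assms(3)]
  using y_mono_le[OF assms(1), of \<omega>] r_mono_le[OF assms(1), of \<omega>] y_pos[of s \<omega>] r_ge_1[of s \<omega>] p
  by (intro mult_mono powr_mono2) auto

end

section \<open>Measurability of the iterates, also with respect to the samples seen so far\<close>

lemma indep_samples: "M.indep_vars (\<lambda>_. D) \<xi> {1..}"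
  using iid by (simp add: iid_samples_def)

lemma distr_sample: "t \<ge> 1 \<Longrightarrow> distr M D (\<xi> t) = D"
  using iid by (simp add: iid_samples_def)

lemma measurable_sample: "t \<ge> 1 \<Longrightarrow> \<xi> t \<in> M \<rightarrow>\<^sub>M D"
  using indep_samples by (auto simp: M.indep_vars_def)

lemma measurable_S_aux:
  assumes "\<And>i. i \<in> {1..k} \<Longrightarrow> x i \<in> borel_measurable N" "\<And>i. i \<in> {1..k} \<Longrightarrow> \<xi> i \<in> N \<rightarrow>\<^sub>M D"
  shows "S k \<in> borel_measurable N"
  unfolding S_def g_def
  by (intro borel_measurable_add borel_measurable_const borel_measurable_sum borel_measurable_divide
      borel_measurable_power measurable_compose[OF _ borel_measurable_norm] measurable_stoch_grad_comp assms)

text \<open>N is kept general to cover both M and the filtration. The shift between the two claims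
  is essential: \<open>x (Suc k)\<close> is determined by k samples, \<open>d (Suc k)\<close> needs
  one more. The induction is strong because \<open>S k\<close> and \<open>y k\<close> involve all
  earlier iterates.\<close>

lemma measurable_iterates:
  assumes sp: "space N = space M" and \<xi>: "\<And>i. i \<in> {1..n} \<Longrightarrow> \<xi> i \<in> N \<rightarrow>\<^sub>M D"
    and "k \<le> T"
  shows "(k \<le> n \<longrightarrow> x (Suc k) \<in> borel_measurable N) \<and> (Suc k \<le> n \<longrightarrow> d (Suc k) \<in> borel_measurable N)"
  using \<open>k \<le> T\<close>
proof (induction k rule: less_induct)
  case (less k)
  show ?case
  proof (cases k)
    case 0
    have x: "x 1 \<in> borel_measurable N"
      \<comment> \<open>The recursion constrains the iterates on \<open>space M\<close> only, hence
        the passage to an explicit expression here and below.\<close>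
      by (subst measurable_cong[where g = "\<lambda>_. x1"]) (auto simp: x_1 sp simp del: One_nat_def)
    have "d 1 \<in> borel_measurable N" if "1 \<le> n"
      using x \<xi>[of 1] that
      by (subst measurable_cong[where g = "g 1"])
         (auto simp: d_1 sp g_def[abs_def] simp del: One_nat_def intro!: measurable_stoch_grad_comp)
    with x 0 show ?thesis by simp
  next
    case (Suc m)
    have k: "k \<in> {1..T}" using less.prems Suc by simp
    have xs: "x i \<in> borel_measurable N" if "i \<in> {1..k}" "k \<le> n" for i
      using less.IH[of "i - 1"] less.prems that by auto
    have ds: "d i \<in> borel_measurable N" if "i \<in> {1..k}" "k \<le> n" for i
      using less.IH[of "i - 1"] less.prems that by auto
    have S: "S k \<in> borel_measurable N" if "k \<le> n"
      using that xs \<xi> by (intro measurable_S_aux) auto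
    have x: "x (Suc k) \<in> borel_measurable N" if kn: "k \<le> n"
    proof -
      have [measurable]: "S k \<in> borel_measurable N" "x k \<in> borel_measurable N" "d k \<in> borel_measurable N"
        using S[OF kn] xs[OF _ kn, of k] ds[OF _ kn, of k] k by auto
      have [measurable]: "y k \<in> borel_measurable N"
        unfolding y_def using ds[OF _ kn] by measurable
      show ?thesis
        by (subst measurable_cong[where g = "\<lambda>\<omega>. x k \<omega> - (\<eta> / (y k \<omega> powr p * (S k \<omega> powr (1 / 3)) powr (1 - p))) *\<^sub>R d k \<omega>"])
           (auto simp: sp x_Suc[OF _ k] b_eq[OF _ k] r_def)
    qed
    have "d (Suc k) \<in> borel_measurable N" if kn: "Suc k \<le> n"
    proof -
      have [measurable]: "S k \<in> borel_measurable N" "x k \<in> borel_measurable N" "d k \<in> borel_measurable N"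
        "x (Suc k) \<in> borel_measurable N" "\<xi> (Suc k) \<in> N \<rightarrow>\<^sub>M D"
        using S xs[of k] ds[of k] x k kn \<xi>[of "Suc k"] by auto
      have [measurable]: "(\<lambda>\<omega>. stoch_grad f (x (Suc k) \<omega>) (\<xi> (Suc k) \<omega>)) \<in> borel_measurable N"
        "(\<lambda>\<omega>. stoch_grad f (x k \<omega>) (\<xi> (Suc k) \<omega>)) \<in> borel_measurable N"
        by (rule measurable_stoch_grad_comp; measurable)+
      show ?thesis
        by (subst measurable_cong[where g = "\<lambda>\<omega>. stoch_grad f (x (Suc k) \<omega>) (\<xi> (Suc k) \<omega>) +
            (1 - 1 / (S k \<omega> powr (1 / 3))\<^sup>2) *\<^sub>R (d k \<omega> - stoch_grad f (x k \<omega>) (\<xi> (Suc k) \<omega>))"])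
           (auto simp: sp d_Suc[OF _ k] r_def)
    qed
    with x show ?thesis by blast
  qed
qed

abbreviation F :: "nat \<Rightarrow> 'w measure" where "F \<equiv> sample_algebra M D \<xi>"

lemma measurable_sample_F: "i \<in> {1..n} \<Longrightarrow> \<xi> i \<in> F n \<rightarrow>\<^sub>M D"
  by (rule M.measurable_sample_algebra) (auto intro: measurable_sample)

lemma measurable_x_F: "1 \<le> t \<Longrightarrow> t \<le> Suc n \<Longrightarrow> t \<le> Suc T \<Longrightarrow> x t \<in> borel_measurable (F n)"
  using measurable_iterates[of "F n" n "t - 1"] measurable_sample_F by auto

lemma measurable_d_F: "1 \<le> t \<Longrightarrow> t \<le> n \<Longrightarrow> t \<le> Suc T \<Longrightarrow> d t \<in> borel_measurable (F n)"
  using measurable_iterates[of "F n" n "t - 1"] measurable_sample_F by auto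

lemma measurable_S_F: "t \<le> n \<Longrightarrow> t \<le> Suc T \<Longrightarrow> S t \<in> borel_measurable (F n)"
  using measurable_x_F measurable_sample_F by (intro measurable_S_aux) auto

lemma measurable_r_F: "t \<le> n \<Longrightarrow> t \<le> Suc T \<Longrightarrow> r t \<in> borel_measurable (F n)"
  using measurable_S_F[of t n] unfolding r_def by measurable

lemma measurable_x: "t \<in> {1..Suc T} \<Longrightarrow> x t \<in> borel_measurable M"
  using measurable_iterates[of M "Suc T" "t - 1"] measurable_sample by auto

lemma measurable_d: "t \<in> {1..Suc T} \<Longrightarrow> d t \<in> borel_measurable M"
  using measurable_iterates[of M "Suc T" "t - 1"] measurable_sample by auto

lemma measurable_g: "t \<in> {1..Suc T} \<Longrightarrow> g t \<in> borel_measurable M"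
  unfolding g_def by (intro measurable_stoch_grad_comp measurable_x measurable_sample) auto

lemma measurable_e: "t \<in> {1..Suc T} \<Longrightarrow> e t \<in> borel_measurable M"
  unfolding e_def using measurable_d[of t] measurable_x[of t] by measurable

lemma measurable_S: "t \<le> Suc T \<Longrightarrow> S t \<in> borel_measurable M"
  by (intro measurable_S_aux measurable_x measurable_sample) auto

lemma measurable_r: "t \<le> Suc T \<Longrightarrow> r t \<in> borel_measurable M"
  using measurable_S[of t] unfolding r_def by measurable

lemma measurable_y: "t \<le> Suc T \<Longrightarrow> y t \<in> borel_measurable M"
  unfolding y_def
  by (intro borel_measurable_add borel_measurable_const borel_measurable_sum
      borel_measurable_power measurable_compose[OF _ borel_measurable_norm] measurable_d) auto

lemma measurable_b: "t \<in> {1..T} \<Longrightarrow> b t \<in> borel_measurable M"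
  using measurable_y[of t] measurable_r[of t]
  by (subst measurable_cong[where g = "\<lambda>\<omega>. y t \<omega> powr p * r t \<omega> powr (1 - p)"]) (auto simp: b_eq)

end

section \<open>Error recursion and descent\<close>

text \<open>Compare y with K r. If \<open>y \<ge> K * r\<close>, then
  \<open>r / b = (r / y) powr p\<close> is at most \<open>K powr (- p)\<close>. Otherwise
  \<open>r / b^2 = (y / r) powr (1 - 2 * p) / y\<close>, and \<open>p \<le> 1 / 2\<close> makes the
  power monotone. Terms of the first kind are absorbed by \<open>dir_sum\<close>, those of the
  second kind sum to a logarithm.\<close>

lemma step_weight_split:
  fixes K p r y :: real
  assumes "K > 0" "r > 0" "y > 0" "0 < p" "p \<le> 1 / 2"
  defines "b \<equiv> y powr p * r powr (1 - p)"
  shows "r / b\<^sup>2 \<le> K powr (- p) / b + K powr (1 - 2 * p) / y"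
proof -
  have b: "b > 0" using assms by (simp add: b_def)
  have rb: "r / b = (r / y) powr p"
  proof -
    have "r = r powr p * r powr (1 - p)" using assms by (simp flip: powr_add)
    then show ?thesis using assms by (simp add: b_def powr_divide field_simps)
  qed
  have "0 \<le> K powr (- p) / b" "0 \<le> K powr (1 - 2 * p) / y" using b assms by auto
  moreover have "r / b\<^sup>2 \<le> K powr (- p) / b \<or> r / b\<^sup>2 \<le> K powr (1 - 2 * p) / y"
  proof (cases "y \<ge> K * r")
    case True
    then have "(r / y) powr p \<le> (1 / K) powr p"
      using assms by (intro powr_mono2) (auto simp: field_simps)
    then have "r / b \<le> K powr (- p)"
      unfolding rb using assms by (simp add: powr_divide powr_minus_divide)
    then have "r / b / b \<le> K powr (- p) / b" using b by (intro divide_right_mono) auto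
    then show ?thesis by (simp add: power2_eq_square)
  next
    case False
    have "r / b\<^sup>2 = (r / b) * (r / b) / r" using assms by (simp add: power2_eq_square)
    also have "\<dots> = (r / y) powr (2 * p - 1) / y"
    proof -
      have "(r / y) powr p * (r / y) powr p = (r / y) powr (2 * p - 1) * (r / y)"
        using assms powr_add[of "r / y" "2 * p - 1" 1] powr_add[of "r / y" p p] by simp
      then show ?thesis unfolding rb using assms by (simp add: field_simps)
    qed
    also have "(r / y) powr (2 * p - 1) = (y / r) powr (1 - 2 * p)"
      using assms powr_minus[of "r / y" "1 - 2 * p"] by (simp add: powr_divide)
    also have "\<dots> \<le> K powr (1 - 2 * p)"
      using False assms by (intro powr_mono2) (auto simp: field_simps)
    finally show ?thesis using assms by (simp add: divide_right_mono)
  qed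
  ultimately show ?thesis by linarith
qed

text \<open>AM-GM with weight \<open>K powr (- p)\<close> on the error part \<open>u^2 / r\<close>.
  What remains is \<open>v^2 * r / b^2\<close> divided by that weight, which
  \<open>step_weight_split\<close> resolves.\<close>

lemma step_cross_term_le:
  fixes K p r y u v :: real
  assumes K: "K > 0" and r: "r > 0" and y: "y > 0" and p: "0 < p" "p \<le> 1 / 2"
  defines "b \<equiv> y powr p * r powr (1 - p)"
  shows "u * v / b \<le> 1 / 2 * (v\<^sup>2 / b) + 1 / 2 * K powr (- p) * (u\<^sup>2 / r) + 1 / 2 * K powr (1 - p) * (v\<^sup>2 / y)"
proof -
  define l where "l = K powr (- p)"
  have l: "l > 0" using K by (simp add: l_def)
  have b: "b > 0" using r y by (simp add: b_def)
  \<comment> \<open>The divisor \<open>l * r\<close> makes the cross term of the square exactly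
    \<open>2 * (u * v / b)\<close>.\<close>
  have "0 \<le> (l * u - v * r / b)\<^sup>2 / (l * r)" using l r by simp
  also have "\<dots> = l * (u\<^sup>2 / r) + v\<^sup>2 * (r / b\<^sup>2) / l - 2 * (u * v / b)"
    using l r b by (simp add: field_simps power2_eq_square)
  finally have "2 * (u * v / b) \<le> l * (u\<^sup>2 / r) + v\<^sup>2 * (r / b\<^sup>2) / l" by simp
  also have "v\<^sup>2 * (r / b\<^sup>2) / l \<le> v\<^sup>2 * (l / b + K powr (1 - 2 * p) / y) / l"
    using step_weight_split[OF K r y p] l
    by (intro divide_right_mono mult_left_mono) (auto simp: l_def b_def)
  also have "\<dots> = v\<^sup>2 / b + K powr (1 - 2 * p) / l * (v\<^sup>2 / y)"
    using l b y by (simp add: field_simps)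
  also have "K powr (1 - 2 * p) / l = K powr (1 - p)"
    using K by (simp add: l_def flip: powr_diff)
  finally have "2 * (u * v / b) \<le> K powr (- p) * (u\<^sup>2 / r) + (v\<^sup>2 / b + K powr (1 - p) * (v\<^sup>2 / y))"
    by (simp add: l_def)
  moreover have "\<And>X A B C :: real. 2 * X \<le> A + (B + C) \<Longrightarrow> X \<le> 1 / 2 * B + 1 / 2 * A + 1 / 2 * C"
    by linarith
  ultimately show ?thesis unfolding mult.assoc by blast
qed

text \<open>Inserting the factor r >= 1 makes \<open>step_weight_split\<close> applicable;
  \<open>2 * c \<le> K powr p\<close> then cancels the factor \<open>K powr (- p)\<close> and leaves
  the coefficient 1/4.\<close>

lemma step_second_order_le:
  fixes K p r y v c :: real
  assumes K: "K > 0" and r: "r \<ge> 1" and y: "y > 0" and p: "0 < p" "p \<le> 1 / 2"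
    and c: "0 \<le> c" "2 * c \<le> K powr p"
  defines "b \<equiv> y powr p * r powr (1 - p)"
  shows "c / 2 * (v\<^sup>2 / b\<^sup>2) \<le> 1 / 4 * (v\<^sup>2 / b) + 1 / 4 * K powr (1 - p) * (v\<^sup>2 / y)"
proof -
  have b: "b > 0" using r y by (simp add: b_def)
  have "c / 2 * (v\<^sup>2 / b\<^sup>2) \<le> K powr p / 4 * (v\<^sup>2 / b\<^sup>2)"
    using c by (intro mult_right_mono) auto
  also have "v\<^sup>2 / b\<^sup>2 \<le> v\<^sup>2 * (r / b\<^sup>2)"
    using r b mult_left_mono[of 1 r "v\<^sup>2"] by (simp add: divide_right_mono)
  also have "v\<^sup>2 * (r / b\<^sup>2) \<le> v\<^sup>2 * (K powr (- p) / b + K powr (1 - 2 * p) / y)"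
    using step_weight_split[OF K _ y p, of r] r by (intro mult_left_mono) (auto simp: b_def)
  also have "K powr p / 4 * (v\<^sup>2 * (K powr (- p) / b + K powr (1 - 2 * p) / y))
      = 1 / 4 * (K powr p * K powr (- p)) * (v\<^sup>2 / b) + 1 / 4 * (K powr p * K powr (1 - 2 * p)) * (v\<^sup>2 / y)"
    by (simp add: field_simps)
  also have "\<dots> = 1 / 4 * (v\<^sup>2 / b) + 1 / 4 * K powr (1 - p) * (v\<^sup>2 / y)"
    using K by (simp flip: powr_add)
  finally show ?thesis using K by (simp add: mult_left_mono)
qed

text \<open>As the cube grows by at most R, r grows by at most \<open>R / r^2\<close>. This is
  exactly what the factor \<open>1 - 1 / r^2\<close> removes from the constant part R of the
  weight.\<close>

lemma cube_weight_step:
  fixes r r' R :: real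
  assumes "1 \<le> r'" "r' \<le> r" "r ^ 3 - r' ^ 3 \<le> R" "0 \<le> R"
  shows "(r + R) * (1 - 1 / r\<^sup>2) \<le> r' + R - 1 / r"
proof -
  have "(r - r') * r\<^sup>2 \<le> (r - r') * (r\<^sup>2 + r * r' + r'\<^sup>2)"
    using assms by (intro mult_left_mono) auto
  also have "\<dots> = r ^ 3 - r' ^ 3" by (simp add: power2_eq_square power3_eq_cube algebra_simps)
  finally have "(r - r') * r\<^sup>2 \<le> R" using assms by simp
  then have "r - r' \<le> R / r\<^sup>2" using assms by (simp add: pos_le_divide_eq)
  moreover have "(r + R) * (1 - 1 / r\<^sup>2) = r + R - 1 / r - R / r\<^sup>2"
    using assms by (simp add: field_simps power2_eq_square)
  ultimately show ?thesis by linarith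
qed

lemma one_minus_ratio_le_ln:
  fixes u v :: real
  assumes "0 < u" "0 < v"
  shows "(v - u) / v \<le> ln v - ln u"
proof -
  have "ln (u / v) \<le> u / v - 1" using assms by (intro ln_le_minus_one) auto
  then show ?thesis using assms by (simp add: ln_div diff_divide_distrib)
qed

section \<open>Almost sure bounds along a run\<close>

context storm_run
begin

text \<open>One almost sure event on which all pathwise estimates hold. The bound is uniform in z
  because gradients are evaluated at random iterates.\<close>

definition tame :: "'w \<Rightarrow> bool" where
  "tame \<omega> \<longleftrightarrow> \<omega> \<in> space M \<and> (\<forall>t\<ge>1. \<forall>z. norm (stoch_grad f z (\<xi> t \<omega>)) \<le> G)"

lemma tame_space: "tame \<omega> \<Longrightarrow> \<omega> \<in> space M"
  by (simp add: tame_def)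

lemma AE_tame: "AE \<omega> in M. tame \<omega>"
proof -
  \<comment> \<open>Only samples with index at least 1 are known to have law D.\<close>
  have "AE \<omega> in M. 1 \<le> t \<longrightarrow> (\<forall>z. norm (stoch_grad f z (\<xi> t \<omega>)) \<le> G)" for t
  proof (cases "1 \<le> t")
    case True
    have "AE s in distr M D (\<xi> t). \<forall>z. norm (stoch_grad f z s) \<le> G"
      unfolding distr_sample[OF True] by (rule bounded_grad)
    from AE_distrD[OF measurable_sample[OF True] this] show ?thesis by eventually_elim auto
  qed auto
  then have "AE \<omega> in M. \<forall>t. 1 \<le> t \<longrightarrow> (\<forall>z. norm (stoch_grad f z (\<xi> t \<omega>)) \<le> G)"
    by (simp add: AE_all_countable)
  with AE_space show ?thesis by eventually_elim (auto simp: tame_def)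
qed

lemma norm_stoch_grad_tame: "tame \<omega> \<Longrightarrow> 1 \<le> t \<Longrightarrow> norm (stoch_grad f z (\<xi> t \<omega>)) \<le> G"
  by (simp add: tame_def)

lemma norm_g_le: "tame \<omega> \<Longrightarrow> 1 \<le> t \<Longrightarrow> norm (g t \<omega>) \<le> G"
  by (simp add: g_def norm_stoch_grad_tame)

lemma g_sq_le: "tame \<omega> \<Longrightarrow> 1 \<le> t \<Longrightarrow> (norm (g t \<omega>))\<^sup>2 / a0\<^sup>2 \<le> R"
  unfolding R_def by (intro divide_right_mono power_mono norm_g_le) auto

lemma inverse_r_sq_le: "0 \<le> 1 / (r t \<omega>)\<^sup>2" "1 / (r t \<omega>)\<^sup>2 \<le> 1"
  using r_ge_1[of t \<omega>] by auto

text \<open>Each update adds at most 2 G, since \<open>1 - a\<close> lies in [0, 1]. Linear growth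
  is crude, but the bound serves only for integrability and inside a logarithm.\<close>

lemma norm_d_le:
  assumes "tame \<omega>" "t \<le> T"
  shows "norm (d (Suc t) \<omega>) \<le> 2 * G * real (Suc t)"
  using assms(2)
proof (induction t)
  case 0
  show ?case
    using norm_g_le[OF assms(1), of 1] d_1[OF tame_space[OF assms(1)]] G by simp
next
  case (Suc t)
  let ?c = "1 / (r (Suc t) \<omega>)\<^sup>2" and ?h = "\<lambda>z. stoch_grad f z (\<xi> (Suc (Suc t)) \<omega>)"
  have "norm (d (Suc (Suc t)) \<omega>)
      = norm (?h (x (Suc (Suc t)) \<omega>) + (1 - ?c) *\<^sub>R (d (Suc t) \<omega> - ?h (x (Suc t) \<omega>)))"
    using Suc.prems by (subst d_Suc[OF tame_space[OF assms(1)]]) auto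
  also have "\<dots> \<le> norm (?h (x (Suc (Suc t)) \<omega>)) + \<bar>1 - ?c\<bar> * norm (d (Suc t) \<omega> - ?h (x (Suc t) \<omega>))"
    by (rule order.trans[OF norm_triangle_ineq]) simp
  also have "\<dots> \<le> G + 1 * (2 * G * real (Suc t) + G)"
  proof (intro add_mono mult_mono)
    show "norm (d (Suc t) \<omega> - ?h (x (Suc t) \<omega>)) \<le> 2 * G * real (Suc t) + G"
      using Suc norm_stoch_grad_tame[OF assms(1), of "Suc (Suc t)"]
      by (intro order.trans[OF norm_triangle_ineq4] add_mono) auto
  qed (use norm_stoch_grad_tame[OF assms(1)] inverse_r_sq_le[of "Suc t" \<omega>] in auto)
  finally show ?case by (simp add: algebra_simps)
qed

lemma S_le: "tame \<omega> \<Longrightarrow> S t \<omega> \<le> 1 + R * real t"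
proof (induction t)
  case (Suc t)
  then show ?case using g_sq_le[of \<omega> "Suc t"] by (simp add: S_Suc algebra_simps)
qed (simp add: S_def)

lemma y_le:
  assumes "tame \<omega>"
  shows "y T \<omega> \<le> b0 powr (1 / p) + 4 * G\<^sup>2 * real T ^ 3"
proof -
  have "(\<Sum>i=1..T. (norm (d i \<omega>))\<^sup>2) \<le> (\<Sum>i=1..T. (2 * G * real T)\<^sup>2)"
  proof (intro sum_mono power_mono)
    fix i assume i: "i \<in> {1..T}"
    then have "i - 1 \<le> T" "Suc (i - 1) = i" by auto
    then have "norm (d i \<omega>) \<le> 2 * G * real i" using norm_d_le[OF assms, of "i - 1"] by simp
    also have "\<dots> \<le> 2 * G * real T" using i G by (intro mult_left_mono) auto
    finally show "norm (d i \<omega>) \<le> 2 * G * real T" .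
  qed auto
  then show ?thesis by (simp add: y_def power2_eq_square power3_eq_cube algebra_simps)
qed

lemma AE_bounded_d: "t \<in> {1..Suc T} \<Longrightarrow> AE_bounded M (d t)"
  using AE_tame by (intro AE_boundedI[where C = "2 * G * real t"], eventually_elim)
    (use norm_d_le[of _ "t - 1"] in auto)

lemma AE_bounded_g: "1 \<le> t \<Longrightarrow> AE_bounded M (g t)"
  using AE_tame by (intro AE_boundedI[where C = G], eventually_elim) (auto intro: norm_g_le)

lemma AE_bounded_grad_obj: "AE_bounded M (\<lambda>\<omega>. grad_obj (X \<omega>))"
  using norm_grad_obj_le by (intro AE_boundedI) auto

lemma AE_bounded_e: "t \<in> {1..Suc T} \<Longrightarrow> AE_bounded M (e t)"
  unfolding e_def by (intro AE_bounded_diff AE_bounded_d AE_bounded_grad_obj)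

lemma AE_bounded_S: "AE_bounded M (S t)"
  using AE_tame
  by (intro AE_boundedI[where C = "1 + R * real t"], eventually_elim)
     (metis S_ge_1 S_le abs_of_nonneg order.trans real_norm_def zero_le_one)

lemma r_le_S: "r t \<omega> \<le> S t \<omega>"
proof -
  have "S t \<omega> powr (1 / 3) \<le> S t \<omega> powr 1"
    using S_ge_1[of t \<omega>] by (intro powr_mono) auto
  then show ?thesis using S_ge_1[of t \<omega>] by (simp add: r_def)
qed

lemma AE_bounded_r: "AE_bounded M (r t)"
  using AE_tame
  by (intro AE_boundedI[where C = "1 + R * real t"], eventually_elim)
     (metis S_le abs_of_nonneg norm_ge_zero order.trans r_ge_1 r_le_S real_norm_def zero_le_one)

lemma AE_bounded_inverse_r: "AE_bounded M (\<lambda>\<omega>. 1 / r t \<omega>)"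
proof (rule AE_boundedI[OF AE_I2])
  fix \<omega> show "norm (1 / r t \<omega>) \<le> 1" using r_ge_1[of t \<omega>] by simp
qed

lemma AE_bounded_inverse_S: "AE_bounded M (\<lambda>\<omega>. 1 / S t \<omega>)"
proof (rule AE_boundedI[OF AE_I2])
  fix \<omega> show "norm (1 / S t \<omega>) \<le> 1" using S_ge_1[of t \<omega>] by simp
qed

lemma AE_bounded_inverse_b: "t \<in> {1..T} \<Longrightarrow> AE_bounded M (\<lambda>\<omega>. 1 / b t \<omega>)"
  using b_ge b0 by (intro AE_boundedI[where C = "1 / b0"] AE_I2)
    (smt (verit, best) divide_nonneg_nonneg frac_le real_norm_def)

lemmas AE_bounded_process = AE_bounded_d AE_bounded_g AE_bounded_e AE_bounded_S AE_bounded_r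
  AE_bounded_divide[OF _ AE_bounded_inverse_r] AE_bounded_divide[OF _ AE_bounded_inverse_S]
  AE_bounded_divide[OF _ AE_bounded_inverse_b]

text \<open>The weight \<open>r t + R\<close> is known before sample t + 1 is drawn, so the one-step
  estimate can be multiplied by it and applied with the past frozen. \<open>cube_weight_step\<close>
  then turns the weight of the old error into \<open>r (t - 1) + R\<close> minus
  \<open>1 / r t\<close>: the first part telescopes, the second produces the left-hand sum.\<close>

lemma error_recursion:
  assumes t: "t \<in> {1..T}"
  shows "M.expectation (\<lambda>\<omega>. (norm (e t \<omega>))\<^sup>2 / r t \<omega>) + M.expectation (\<lambda>\<omega>. (r t \<omega> + R) * (norm (e (Suc t) \<omega>))\<^sup>2)
    \<le> M.expectation (\<lambda>\<omega>. (r (t - 1) \<omega> + R) * (norm (e t \<omega>))\<^sup>2)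
      + (1 + R) * (2 * \<beta>\<^sup>2 * \<eta>\<^sup>2 * M.expectation (\<lambda>\<omega>. r t \<omega> * ((norm (d t \<omega>))\<^sup>2 * (1 / b t \<omega>)\<^sup>2))
        + 2 * M.expectation (\<lambda>\<omega>. (norm (g (Suc t) \<omega>))\<^sup>2 / S t \<omega>))"
proof -
  define c where "c = (\<lambda>\<omega>. 1 / (r t \<omega>)\<^sup>2)"
  \<comment> \<open>\<open>h1\<close> and \<open>h2\<close> separate the past
    \<open>\<omega>\<close> from the fresh sample s. At the actual sample, \<open>h1\<close> is the
    weighted next error and \<open>h2\<close> the weighted squared gradient; A collects what depends
    on the past alone.\<close>
  define h1 where "h1 = (\<lambda>(\<omega>, s). (r t \<omega> + R) * (norm (stoch_grad f (x (Suc t) \<omega>) s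
      + (1 - c \<omega>) *\<^sub>R (d t \<omega> - stoch_grad f (x t \<omega>) s) - grad_obj (x (Suc t) \<omega>)))\<^sup>2)"
  define A where "A = (\<lambda>\<omega>. (r t \<omega> + R) * ((1 - c \<omega>) * (norm (e t \<omega>))\<^sup>2
      + 2 * (\<beta>\<^sup>2 * (\<eta>\<^sup>2 * ((norm (d t \<omega>))\<^sup>2 * (1 / b t \<omega>)\<^sup>2)))))"
  define B where "B = (\<lambda>\<omega>. (r t \<omega> + R) * (2 * (c \<omega>)\<^sup>2))"
  define h2 where "h2 = (\<lambda>(\<omega>, s). B \<omega> * (norm (stoch_grad f (x (Suc t) \<omega>) s))\<^sup>2)"
  have mF [measurable]: "x t \<in> borel_measurable (F t)" "x (Suc t) \<in> borel_measurable (F t)"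
      "d t \<in> borel_measurable (F t)" "r t \<in> borel_measurable (F t)"
    using t by (auto intro: measurable_x_F measurable_d_F measurable_r_F)
  have mM [measurable]: "x t \<in> borel_measurable M" "x (Suc t) \<in> borel_measurable M"
      "d t \<in> borel_measurable M" "r t \<in> borel_measurable M" "e t \<in> borel_measurable M"
      "e (Suc t) \<in> borel_measurable M" "g (Suc t) \<in> borel_measurable M" "b t \<in> borel_measurable M"
      "r (t - 1) \<in> borel_measurable M" "S t \<in> borel_measurable M"
    using t by (auto intro: measurable_x measurable_d measurable_r measurable_e measurable_g measurable_b measurable_S)
  have [measurable]: "(\<lambda>z. stoch_grad f (x t (fst z)) (snd z)) \<in> borel_measurable (F t \<Otimes>\<^sub>M D)"
      "(\<lambda>z. stoch_grad f (x (Suc t) (fst z)) (snd z)) \<in> borel_measurable (F t \<Otimes>\<^sub>M D)"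
    by (rule measurable_stoch_grad_comp; measurable)+
  have c01: "0 \<le> c \<omega>" "c \<omega> \<le> 1" for \<omega> using inverse_r_sq_le[of t \<omega>] by (auto simp: c_def)
  have c_bdd: "AE_bounded M c"
    using c01 by (intro AE_boundedI[where C = 1]) auto
  have bdd: "AE_bounded M A" "AE_bounded M B"
    unfolding A_def B_def using t
    by (auto intro!: AE_bounded_intros AE_bounded_process c_bdd simp del: One_nat_def)
  have [measurable]: "c \<in> borel_measurable M" "A \<in> borel_measurable M" "B \<in> borel_measurable M"
      "c \<in> borel_measurable (F t)" "B \<in> borel_measurable (F t)"
    unfolding A_def B_def c_def by measurable
  have h1_eq: "h1 (\<omega>, \<xi> (Suc t) \<omega>) = (r t \<omega> + R) * (norm (e (Suc t) \<omega>))\<^sup>2" if "\<omega> \<in> space M" for \<omega>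
    by (simp add: h1_def e_def d_Suc[OF that t] c_def)
  have h2_eq: "h2 (\<omega>, \<xi> (Suc t) \<omega>) = B \<omega> * (norm (g (Suc t) \<omega>))\<^sup>2" for \<omega>
    by (simp add: h2_def g_def)
  have int_e': "integrable M (\<lambda>\<omega>. (r t \<omega> + R) * (norm (e (Suc t) \<omega>))\<^sup>2)"
    using t by (intro M.integrable_AE_bounded AE_bounded_intros AE_bounded_process) auto
  then have int1: "integrable M (\<lambda>\<omega>. h1 (\<omega>, \<xi> (Suc t) \<omega>))"
    by (subst Bochner_Integration.integrable_cong[OF refl h1_eq])
  have int2: "integrable M (\<lambda>\<omega>. h2 (\<omega>, \<xi> (Suc t) \<omega>))"
    unfolding h2_eq using t by (intro M.integrable_AE_bounded AE_bounded_intros AE_bounded_process bdd) auto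
  have intA: "integrable M A" by (intro M.integrable_AE_bounded bdd) measurable
  have mh: "h1 \<in> borel_measurable (F t \<Otimes>\<^sub>M D)" "h2 \<in> borel_measurable (F t \<Otimes>\<^sub>M D)"
    unfolding h1_def h2_def split_beta by measurable
  note cond1 = M.sample_algebra_expectation[OF indep_samples distr_sample mh(1) int1, simplified]
  note cond2 = M.sample_algebra_expectation[OF indep_samples distr_sample mh(2) int2, simplified]
  have inner: "(\<integral>s. h1 (\<omega>, s) \<partial>D) \<le> A \<omega> + (\<integral>s. h2 (\<omega>, s) \<partial>D)" if \<omega>: "\<omega> \<in> space M" for \<omega>
  proof -
    have xd: "(norm (x (Suc t) \<omega> - x t \<omega>))\<^sup>2 = \<eta>\<^sup>2 * ((norm (d t \<omega>))\<^sup>2 * (1 / b t \<omega>)\<^sup>2)"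
      unfolding x_Suc[OF \<omega> t] by (simp add: power_mult_distrib power_divide)
    have "(\<integral>s. h1 (\<omega>, s) \<partial>D) = (r t \<omega> + R) * (\<integral>s. (norm (stoch_grad f (x (Suc t) \<omega>) s
      + (1 - c \<omega>) *\<^sub>R (d t \<omega> - stoch_grad f (x t \<omega>) s) - grad_obj (x (Suc t) \<omega>)))\<^sup>2 \<partial>D)"
      by (simp add: h1_def)
    also have "\<dots> \<le> (r t \<omega> + R) * ((1 - c \<omega>) * (norm (d t \<omega> - grad_obj (x t \<omega>)))\<^sup>2
        + 2 * (\<beta>\<^sup>2 * (norm (x (Suc t) \<omega> - x t \<omega>))\<^sup>2)
        + 2 * (c \<omega>)\<^sup>2 * (\<integral>s. (norm (stoch_grad f (x (Suc t) \<omega>) s))\<^sup>2 \<partial>D))"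
      using c01 r_ge_1[of t \<omega>] R_nonneg by (intro mult_left_mono expected_estimator_error_le) auto
    also have "\<dots> = A \<omega> + (\<integral>s. h2 (\<omega>, s) \<partial>D)"
      unfolding xd A_def B_def h2_def e_def by (simp add: algebra_simps)
    finally show ?thesis .
  qed
  have "M.expectation (\<lambda>\<omega>. (r t \<omega> + R) * (norm (e (Suc t) \<omega>))\<^sup>2) = M.expectation (\<lambda>\<omega>. h1 (\<omega>, \<xi> (Suc t) \<omega>))"
    by (intro Bochner_Integration.integral_cong refl h1_eq[symmetric])
  also have "\<dots> = M.expectation (\<lambda>\<omega>. \<integral>s. h1 (\<omega>, s) \<partial>D)" by (rule cond1(2))
  also have "\<dots> \<le> M.expectation (\<lambda>\<omega>. A \<omega> + (\<integral>s. h2 (\<omega>, s) \<partial>D))"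
    using inner cond1(1) cond2(1) intA by (intro integral_mono) auto
  \<comment> \<open>Freezing is undone for \<open>h2\<close>, so the integrated second moment
    becomes the observed gradient \<open>g (Suc t)\<close> that enters \<open>S\<close>.\<close>
  also have "\<dots> = M.expectation A + M.expectation (\<lambda>\<omega>. h2 (\<omega>, \<xi> (Suc t) \<omega>))"
    using cond2 intA by simp
  finally have rec: "M.expectation (\<lambda>\<omega>. (r t \<omega> + R) * (norm (e (Suc t) \<omega>))\<^sup>2)
      \<le> M.expectation (\<lambda>\<omega>. A \<omega> + B \<omega> * (norm (g (Suc t) \<omega>))\<^sup>2)"
    using int2 intA unfolding h2_eq by simp

  define Z1 where "Z1 = (\<lambda>\<omega>. (norm (e t \<omega>))\<^sup>2 / r t \<omega>)"
  define Z2 where "Z2 = (\<lambda>\<omega>. (r (t - 1) \<omega> + R) * (norm (e t \<omega>))\<^sup>2)"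
  define Z3 where "Z3 = (\<lambda>\<omega>. r t \<omega> * ((norm (d t \<omega>))\<^sup>2 * (1 / b t \<omega>)\<^sup>2))"
  define Z4 where "Z4 = (\<lambda>\<omega>. (norm (g (Suc t) \<omega>))\<^sup>2 / S t \<omega>)"
  have intZ: "integrable M Z1" "integrable M Z2" "integrable M Z3" "integrable M Z4"
    unfolding Z1_def Z2_def Z3_def Z4_def using t
    by (intro M.integrable_AE_bounded AE_bounded_intros AE_bounded_process; auto simp del: One_nat_def)+
  have ptw: "A \<omega> + B \<omega> * (norm (g (Suc t) \<omega>))\<^sup>2
      \<le> Z2 \<omega> - Z1 \<omega> + (1 + R) * (2 * \<beta>\<^sup>2 * \<eta>\<^sup>2 * Z3 \<omega> + 2 * Z4 \<omega>)" if \<omega>: "tame \<omega>" for \<omega>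
  proof -
    have r: "1 \<le> r t \<omega>" "1 \<le> r (t - 1) \<omega>" "r (t - 1) \<omega> \<le> r t \<omega>"
      using r_ge_1 r_mono_le[of "t - 1" t \<omega>] by auto
    have "r t \<omega> ^ 3 - r (t - 1) \<omega> ^ 3 \<le> R"
      unfolding r_pow3 using S_Suc[of "t - 1" \<omega>] g_sq_le[OF \<omega>, of t] t by simp
    then have "(r t \<omega> + R) * (1 - c \<omega>) \<le> r (t - 1) \<omega> + R - 1 / r t \<omega>"
      unfolding c_def using r R_nonneg by (intro cube_weight_step) auto
    then have "(r t \<omega> + R) * (1 - c \<omega>) * (norm (e t \<omega>))\<^sup>2 \<le> (r (t - 1) \<omega> + R - 1 / r t \<omega>) * (norm (e t \<omega>))\<^sup>2"
      by (intro mult_right_mono) auto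
    then have 1: "(r t \<omega> + R) * ((1 - c \<omega>) * (norm (e t \<omega>))\<^sup>2) \<le> Z2 \<omega> - Z1 \<omega>"
      by (simp add: Z1_def Z2_def left_diff_distrib mult.assoc)
    have w: "r t \<omega> + R \<le> (1 + R) * r t \<omega>"
      using r R_nonneg mult_left_mono[of 1 "r t \<omega>" R] by (simp add: algebra_simps)
    then have 2: "(r t \<omega> + R) * (2 * (\<beta>\<^sup>2 * (\<eta>\<^sup>2 * ((norm (d t \<omega>))\<^sup>2 * (1 / b t \<omega>)\<^sup>2))))
        \<le> ((1 + R) * r t \<omega>) * (2 * (\<beta>\<^sup>2 * (\<eta>\<^sup>2 * ((norm (d t \<omega>))\<^sup>2 * (1 / b t \<omega>)\<^sup>2))))"
      by (intro mult_right_mono) auto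
    have "B \<omega> * (norm (g (Suc t) \<omega>))\<^sup>2 \<le> ((1 + R) * r t \<omega>) * (2 * (c \<omega>)\<^sup>2) * (norm (g (Suc t) \<omega>))\<^sup>2"
      unfolding B_def using w by (intro mult_right_mono) auto
    \<comment> \<open>\<open>r * (1 / r^2)^2 = 1 / r^3\<close>: here the exponent 2/3 in the
      definition of a pays off.\<close>
    also have "r t \<omega> * (c \<omega>)\<^sup>2 = 1 / S t \<omega>"
      using r unfolding c_def r_pow3[symmetric] by (simp add: power2_eq_square power3_eq_cube)
    then have "((1 + R) * r t \<omega>) * (2 * (c \<omega>)\<^sup>2) * (norm (g (Suc t) \<omega>))\<^sup>2 = (1 + R) * (2 * Z4 \<omega>)"
      by (simp add: Z4_def mult.assoc mult.left_commute)
    finally have 3: "B \<omega> * (norm (g (Suc t) \<omega>))\<^sup>2 \<le> (1 + R) * (2 * Z4 \<omega>)" .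
    from 1 2 3 show ?thesis by (simp add: A_def Z3_def algebra_simps)
  qed
  have "M.expectation (\<lambda>\<omega>. A \<omega> + B \<omega> * (norm (g (Suc t) \<omega>))\<^sup>2)
      \<le> M.expectation (\<lambda>\<omega>. Z2 \<omega> - Z1 \<omega> + (1 + R) * (2 * \<beta>\<^sup>2 * \<eta>\<^sup>2 * Z3 \<omega> + 2 * Z4 \<omega>))"
    using AE_tame intZ intA int2[unfolded h2_eq]
    by (intro integral_mono_AE) (auto elim!: eventually_mono intro!: ptw)
  also have "\<dots> = M.expectation Z2 - M.expectation Z1
      + (1 + R) * (2 * \<beta>\<^sup>2 * \<eta>\<^sup>2 * M.expectation Z3 + 2 * M.expectation Z4)"
    using intZ by simp
  finally show ?thesis using rec unfolding Z1_def Z2_def Z3_def Z4_def by linarith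
qed


section \<open>Summed errors, summed directions and logarithmic sums\<close>

definition err_sum :: "'w \<Rightarrow> real" where
  "err_sum \<omega> = (\<Sum>t=1..T. (norm (e t \<omega>))\<^sup>2 / r t \<omega>)"

definition dir_sum :: "'w \<Rightarrow> real" where
  "dir_sum \<omega> = (\<Sum>t=1..T. (norm (d t \<omega>))\<^sup>2 / b t \<omega>)"

lemma y_0: "y 0 \<omega> = b0 powr (1 / p)"
  by (simp add: y_def)

lemma sum_d_sq_over_y_le: "(\<Sum>t=1..n. (norm (d t \<omega>))\<^sup>2 / y t \<omega>) \<le> ln (y n \<omega>) - ln (y 0 \<omega>)"
proof (induction n)
  case (Suc n)
  have "(norm (d (Suc n) \<omega>))\<^sup>2 / y (Suc n) \<omega> \<le> ln (y (Suc n) \<omega>) - ln (y n \<omega>)"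
    using one_minus_ratio_le_ln[of "y n \<omega>" "y (Suc n) \<omega>", OF y_pos y_pos] by (simp add: y_Suc)
  with Suc show ?case by simp
qed simp

text \<open>The denominator lags one step behind the gradient, so the sum does not telescope
  directly. Since \<open>S (Suc t) \<le> (1 + R) * S t\<close>, replacing the denominator by its
  successor costs a factor \<open>1 + R\<close>.\<close>

lemma sum_g_sq_over_S_le:
  assumes "tame \<omega>"
  shows "(\<Sum>t=1..n. (norm (g (Suc t) \<omega>))\<^sup>2 / S t \<omega>) \<le> a0\<^sup>2 * (1 + R) * ln (S (Suc n) \<omega>)"
proof (induction n)
  case 0
  show ?case using S_ge_1[of "Suc 0" \<omega>] R_nonneg by simp
next
  case (Suc n)
  define u v where "u = S (Suc n) \<omega>" and "v = S (Suc (Suc n)) \<omega>"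
  have uv: "u \<ge> 1" "v \<ge> u" using S_ge_1 S_mono by (auto simp: u_def v_def)
  have diff: "(norm (g (Suc (Suc n)) \<omega>))\<^sup>2 = a0\<^sup>2 * (v - u)"
    using a0 by (simp add: u_def v_def S_Suc[of "Suc n"])
  have "v - u \<le> R" using g_sq_le[OF assms, of "Suc (Suc n)"] by (simp add: u_def v_def S_Suc[of "Suc n"])
  also have "R \<le> R * u" using R_nonneg uv mult_left_mono[of 1 u R] by simp
  finally have v: "v \<le> (1 + R) * u" by (simp add: algebra_simps)
  have "(v - u) / u = (v - u) * (v / u) / v" using uv by simp
  also have "\<dots> \<le> (v - u) * (1 + R) / v"
    using uv v by (intro divide_right_mono mult_left_mono) (auto simp: field_simps)
  also have "\<dots> = (1 + R) * ((v - u) / v)" by simp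
  also have "\<dots> \<le> (1 + R) * (ln v - ln u)"
    using uv R_nonneg by (intro mult_left_mono one_minus_ratio_le_ln) auto
  finally have "a0\<^sup>2 * ((v - u) / u) \<le> a0\<^sup>2 * ((1 + R) * (ln v - ln u))"
    by (intro mult_left_mono) auto
  then have "(norm (g (Suc (Suc n)) \<omega>))\<^sup>2 / u \<le> a0\<^sup>2 * (1 + R) * ln v - a0\<^sup>2 * (1 + R) * ln u"
    unfolding diff by (simp add: algebra_simps)
  with Suc show ?case by (simp add: u_def v_def)
qed

lemmas measurable_process = measurable_x measurable_d measurable_g measurable_e measurable_S
  measurable_r measurable_y measurable_b

lemma integrable_err_term: "t \<in> {1..T} \<Longrightarrow> integrable M (\<lambda>\<omega>. (norm (e t \<omega>))\<^sup>2 / r t \<omega>)"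
  by (intro M.integrable_AE_bounded AE_bounded_intros AE_bounded_process borel_measurable_divide
      borel_measurable_power measurable_compose[OF _ borel_measurable_norm] measurable_process) auto

lemma integrable_dir_term: "t \<in> {1..T} \<Longrightarrow> integrable M (\<lambda>\<omega>. (norm (d t \<omega>))\<^sup>2 / b t \<omega>)"
  by (intro M.integrable_AE_bounded AE_bounded_intros AE_bounded_process borel_measurable_divide
      borel_measurable_power measurable_compose[OF _ borel_measurable_norm] measurable_process) auto

lemma integrable_g_term: "t \<in> {1..T} \<Longrightarrow> integrable M (\<lambda>\<omega>. (norm (g (Suc t) \<omega>))\<^sup>2 / S t \<omega>)"
  by (intro M.integrable_AE_bounded AE_bounded_intros AE_bounded_process borel_measurable_divide
      borel_measurable_power measurable_compose[OF _ borel_measurable_norm] measurable_process) auto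

lemma integrable_step_term:
  "t \<in> {1..T} \<Longrightarrow> integrable M (\<lambda>\<omega>. r t \<omega> * ((norm (d t \<omega>))\<^sup>2 * (1 / b t \<omega>)\<^sup>2))"
  by (intro M.integrable_AE_bounded AE_bounded_intros AE_bounded_process borel_measurable_divide
      borel_measurable_times borel_measurable_const
      borel_measurable_power measurable_compose[OF _ borel_measurable_norm] measurable_process) auto

lemma integrable_err_sum: "integrable M err_sum"
  unfolding err_sum_def by (intro Bochner_Integration.integrable_sum integrable_err_term)

lemma integrable_dir_sum: "integrable M dir_sum"
  unfolding dir_sum_def by (intro Bochner_Integration.integrable_sum integrable_dir_term)

lemma err_sum_nonneg: "0 \<le> err_sum \<omega>"
  unfolding err_sum_def using r_ge_1[of _ \<omega>]
  by (intro sum_nonneg divide_nonneg_nonneg) (auto intro: order.trans[OF zero_le_one])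

lemma dir_sum_nonneg: "\<omega> \<in> space M \<Longrightarrow> 0 \<le> dir_sum \<omega>"
  unfolding dir_sum_def using b_ge[of \<omega>] b0
  by (intro sum_nonneg divide_nonneg_nonneg) (auto intro: order.trans[OF less_imp_le])

lemma summed_error_recursion:
  assumes "n \<le> T"
  shows "(\<Sum>t=1..n. M.expectation (\<lambda>\<omega>. (norm (e t \<omega>))\<^sup>2 / r t \<omega>))
      + M.expectation (\<lambda>\<omega>. (r n \<omega> + R) * (norm (e (Suc n) \<omega>))\<^sup>2)
    \<le> (1 + R) * (4 * G\<^sup>2) + (1 + R) *
      (2 * \<beta>\<^sup>2 * \<eta>\<^sup>2 * (\<Sum>t=1..n. M.expectation (\<lambda>\<omega>. r t \<omega> * ((norm (d t \<omega>))\<^sup>2 * (1 / b t \<omega>)\<^sup>2)))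
       + 2 * (\<Sum>t=1..n. M.expectation (\<lambda>\<omega>. (norm (g (Suc t) \<omega>))\<^sup>2 / S t \<omega>)))"
  using assms
proof (induction n)
  case 0
  \<comment> \<open>\<open>S 0 = 1\<close> gives the initial weight \<open>1 + R\<close>; the first
    error is a difference of two vectors of norm at most G.\<close>
  have "AE \<omega> in M. (r 0 \<omega> + R) * (norm (e (Suc 0) \<omega>))\<^sup>2 \<le> (1 + R) * (4 * G\<^sup>2)"
    using AE_tame
  proof eventually_elim
    case (elim \<omega>)
    have "norm (e (Suc 0) \<omega>) \<le> norm (d (Suc 0) \<omega>) + norm (grad_obj (x (Suc 0) \<omega>))"
      unfolding e_def by (rule norm_triangle_ineq4)
    also have "\<dots> \<le> 2 * G"
      using norm_g_le[OF elim, of 1] d_1[OF tame_space[OF elim]] norm_grad_obj_le[of "x (Suc 0) \<omega>"] by simp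
    finally have "(norm (e (Suc 0) \<omega>))\<^sup>2 \<le> (2 * G)\<^sup>2" by (rule power_mono) simp
    then show ?case using R_nonneg by (simp add: r_def S_def mult_left_mono)
  qed
  moreover have "integrable M (\<lambda>\<omega>. (r 0 \<omega> + R) * (norm (e (Suc 0) \<omega>))\<^sup>2)"
    by (intro M.integrable_AE_bounded AE_bounded_intros AE_bounded_process borel_measurable_add
        borel_measurable_times borel_measurable_const
        borel_measurable_power measurable_compose[OF _ borel_measurable_norm] measurable_process) auto
  ultimately have "M.expectation (\<lambda>\<omega>. (r 0 \<omega> + R) * (norm (e (Suc 0) \<omega>))\<^sup>2)
      \<le> M.expectation (\<lambda>_. (1 + R) * (4 * G\<^sup>2))"
    by (intro integral_mono_AE) auto
  then show ?case by (simp add: M.prob_space)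
next
  case (Suc n)
  then show ?case using error_recursion[of "Suc n"] by (simp add: algebra_simps)
qed

lemma sum_step_terms_le:
  assumes "\<omega> \<in> space M" "K > 0"
  shows "(\<Sum>t=1..T. r t \<omega> * ((norm (d t \<omega>))\<^sup>2 * (1 / b t \<omega>)\<^sup>2))
    \<le> K powr (- p) * dir_sum \<omega> + K powr (1 - 2 * p) * (ln (y T \<omega>) - ln (y 0 \<omega>))"
proof -
  have "(\<Sum>t=1..T. r t \<omega> * ((norm (d t \<omega>))\<^sup>2 * (1 / b t \<omega>)\<^sup>2))
      \<le> (\<Sum>t=1..T. K powr (- p) * ((norm (d t \<omega>))\<^sup>2 / b t \<omega>) + K powr (1 - 2 * p) * ((norm (d t \<omega>))\<^sup>2 / y t \<omega>))"
  proof (rule sum_mono)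
    fix t assume t: "t \<in> {1..T}"
    have "r t \<omega> / (b t \<omega>)\<^sup>2 \<le> K powr (- p) / b t \<omega> + K powr (1 - 2 * p) / y t \<omega>"
      unfolding b_eq[OF assms(1) t]
      using r_ge_1[of t \<omega>] y_pos p assms by (intro step_weight_split) auto
    then have "(norm (d t \<omega>))\<^sup>2 * (r t \<omega> / (b t \<omega>)\<^sup>2)
        \<le> (norm (d t \<omega>))\<^sup>2 * (K powr (- p) / b t \<omega> + K powr (1 - 2 * p) / y t \<omega>)"
      by (intro mult_left_mono) auto
    then show "r t \<omega> * ((norm (d t \<omega>))\<^sup>2 * (1 / b t \<omega>)\<^sup>2)
      \<le> K powr (- p) * ((norm (d t \<omega>))\<^sup>2 / b t \<omega>) + K powr (1 - 2 * p) * ((norm (d t \<omega>))\<^sup>2 / y t \<omega>)"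
      by (simp add: algebra_simps power_divide)
  qed
  also have "\<dots> = K powr (- p) * dir_sum \<omega> + K powr (1 - 2 * p) * (\<Sum>t=1..T. (norm (d t \<omega>))\<^sup>2 / y t \<omega>)"
    by (simp add: dir_sum_def sum.distrib sum_distrib_left)
  also have "\<dots> \<le> K powr (- p) * dir_sum \<omega> + K powr (1 - 2 * p) * (ln (y T \<omega>) - ln (y 0 \<omega>))"
    by (intro add_left_mono mult_left_mono sum_d_sq_over_y_le) auto
  finally show ?thesis .
qed

lemma dir_sum_le:
  assumes \<omega>: "\<omega> \<in> space M" and K: "K > 0" "2 * (\<beta> * \<eta>) \<le> K powr p"
  shows "dir_sum \<omega> \<le> 4 * (objective D f x1 - optimal_value D f) / \<eta>
    + 2 * K powr (- p) * err_sum \<omega> + 3 * K powr (1 - p) * (ln (y T \<omega>) - ln (y 0 \<omega>))"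
proof -
  \<comment> \<open>Of the decrease \<open>\<eta> * (norm d)^2 / b\<close>, the cross term with the
    error consumes one half and the second-order term one quarter; the last quarter is kept on the
    left.\<close>
  have step: "objective D f (x (Suc t) \<omega>) + \<eta> / 4 * ((norm (d t \<omega>))\<^sup>2 / b t \<omega>)
    \<le> objective D f (x t \<omega>) + \<eta> / 2 * K powr (- p) * ((norm (e t \<omega>))\<^sup>2 / r t \<omega>)
      + 3 * \<eta> / 4 * K powr (1 - p) * ((norm (d t \<omega>))\<^sup>2 / y t \<omega>)"
    if t: "t \<in> {1..T}" for t
  proof -
    let ?b = "b t \<omega>" and ?d = "d t \<omega>" and ?e = "e t \<omega>"
    have b: "?b > 0" using b_ge[OF \<omega> t] b0 by simp
    have r: "r t \<omega> > 0" "r t \<omega> \<ge> 1" using r_ge_1[of t \<omega>] by auto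
    have diff: "x (Suc t) \<omega> - x t \<omega> = - (\<eta> / ?b) *\<^sub>R ?d" by (simp add: x_Suc[OF \<omega> t])
    have gd: "grad_obj (x t \<omega>) = ?d - ?e" by (simp add: e_def)
    have "objective D f (x (Suc t) \<omega>) \<le> objective D f (x t \<omega>)
        + grad_obj (x t \<omega>) \<bullet> (x (Suc t) \<omega> - x t \<omega>) + \<beta> / 2 * (norm (x (Suc t) \<omega> - x t \<omega>))\<^sup>2"
      using \<beta> by (intro objective_descent) auto
    also have "grad_obj (x t \<omega>) \<bullet> (x (Suc t) \<omega> - x t \<omega>) = \<eta> / ?b * (?e \<bullet> ?d - (norm ?d)\<^sup>2)"
      unfolding diff gd by (simp add: inner_diff_left power2_norm_eq_inner algebra_simps)
    also have "\<dots> \<le> \<eta> / ?b * (norm ?e * norm ?d - (norm ?d)\<^sup>2)"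
      using b \<eta> norm_cauchy_schwarz[of ?e ?d] by (intro mult_left_mono) auto
    also have "\<dots> = \<eta> * (norm ?e * norm ?d / ?b) - \<eta> * ((norm ?d)\<^sup>2 / ?b)"
      by (simp add: algebra_simps)
    also have "norm ?e * norm ?d / ?b \<le> 1 / 2 * ((norm ?d)\<^sup>2 / ?b) + 1 / 2 * K powr (- p) * ((norm ?e)\<^sup>2 / r t \<omega>)
        + 1 / 2 * K powr (1 - p) * ((norm ?d)\<^sup>2 / y t \<omega>)"
      unfolding b_eq[OF \<omega> t] using K r y_pos p by (intro step_cross_term_le) auto
    also have "\<beta> / 2 * (norm (x (Suc t) \<omega> - x t \<omega>))\<^sup>2 = \<eta> * (\<beta> * \<eta> / 2 * ((norm ?d)\<^sup>2 / ?b\<^sup>2))"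
      unfolding diff by (simp add: power_mult_distrib power_divide power2_eq_square)
    also have "\<beta> * \<eta> / 2 * ((norm ?d)\<^sup>2 / ?b\<^sup>2)
        \<le> 1 / 4 * ((norm ?d)\<^sup>2 / ?b) + 1 / 4 * K powr (1 - p) * ((norm ?d)\<^sup>2 / y t \<omega>)"
      unfolding b_eq[OF \<omega> t] using K r y_pos p \<beta> \<eta> by (intro step_second_order_le) auto
    finally show ?thesis using \<eta> by (simp add: algebra_simps)
  qed
  have "objective D f (x (Suc n) \<omega>) + \<eta> / 4 * (\<Sum>t=1..n. (norm (d t \<omega>))\<^sup>2 / b t \<omega>)
    \<le> objective D f x1 + \<eta> / 2 * K powr (- p) * (\<Sum>t=1..n. (norm (e t \<omega>))\<^sup>2 / r t \<omega>)
      + 3 * \<eta> / 4 * K powr (1 - p) * (\<Sum>t=1..n. (norm (d t \<omega>))\<^sup>2 / y t \<omega>)" if "n \<le> T" for n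
    using that
  proof (induction n)
    case 0
    then show ?case using x_1[OF \<omega>] by simp
  next
    case (Suc n)
    then show ?case using step[of "Suc n"] by (simp add: algebra_simps)
  qed
  from this[of T] have "objective D f (x (Suc T) \<omega>) + \<eta> / 4 * dir_sum \<omega>
    \<le> objective D f x1 + \<eta> / 2 * K powr (- p) * err_sum \<omega>
      + 3 * \<eta> / 4 * K powr (1 - p) * (\<Sum>t=1..T. (norm (d t \<omega>))\<^sup>2 / y t \<omega>)"
    by (simp add: dir_sum_def err_sum_def)
  moreover have "optimal_value D f \<le> objective D f (x (Suc T) \<omega>)"
    unfolding optimal_value_def using bounded_below by (intro cINF_lower) auto
  moreover have "3 * \<eta> / 4 * K powr (1 - p) * (\<Sum>t=1..T. (norm (d t \<omega>))\<^sup>2 / y t \<omega>)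
      \<le> 3 * \<eta> / 4 * K powr (1 - p) * (ln (y T \<omega>) - ln (y 0 \<omega>))"
    using \<eta> by (intro mult_left_mono sum_d_sq_over_y_le) auto
  ultimately have "\<eta> / 4 * dir_sum \<omega> \<le> (objective D f x1 - optimal_value D f)
      + \<eta> / 2 * K powr (- p) * err_sum \<omega> + 3 * \<eta> / 4 * K powr (1 - p) * (ln (y T \<omega>) - ln (y 0 \<omega>))"
    by linarith
  from mult_left_mono[OF this, of "4 / \<eta>"] show ?thesis using \<eta> by (simp add: field_simps)
qed

text \<open>A deterministic bound for the logarithm of \<open>y T / y 0\<close>. The cube comes from
  summing squares of directions that grow at most linearly.\<close>

definition ell :: real where
  "ell = ln (1 + 4 * G\<^sup>2 * real T ^ 3 / b0 powr (1 / p))"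

lemma ell_nonneg: "ell \<ge> 0"
  by (simp add: ell_def)

lemma ln_y_ratio_le: "tame \<omega> \<Longrightarrow> ln (y T \<omega>) - ln (y 0 \<omega>) \<le> ell"
proof -
  assume "tame \<omega>"
  have B: "b0 powr (1 / p) > 0" using b0 by simp
  have "ln (y T \<omega>) - ln (y 0 \<omega>) = ln (y T \<omega> / b0 powr (1 / p))"
    using y_pos[of T \<omega>] B by (simp add: ln_div y_0)
  also have "\<dots> \<le> ln ((b0 powr (1 / p) + 4 * G\<^sup>2 * real T ^ 3) / b0 powr (1 / p))"
    using y_le[OF \<open>tame \<omega>\<close>] y_pos[of T \<omega>] B
    by (subst ln_le_cancel_iff) (auto intro!: divide_right_mono divide_pos_pos add_pos_nonneg)
  also have "\<dots> = ell" using B by (simp add: ell_def add_divide_distrib)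
  finally show ?thesis .
qed

text \<open>The part of the bound on \<open>err_sum\<close> without \<open>\<beta>\<close>: the
  first summand stems from the initial error, the second from the fresh gradient noise.\<close>

definition log_const :: real where
  "log_const = 4 * (1 + R) * G\<^sup>2 + 2 * a0\<^sup>2 * (1 + R)\<^sup>2 * ln (1 + R * real (Suc T))"

lemma log_const_nonneg: "log_const \<ge> 0"
  using R_nonneg by (simp add: log_const_def)

lemma expected_err_sum_le:
  assumes K: "K > 0"
  shows "M.expectation err_sum \<le> log_const
    + 2 * (1 + R) * \<beta>\<^sup>2 * \<eta>\<^sup>2 * (K powr (- p) * M.expectation dir_sum + K powr (1 - 2 * p) * ell)"
proof -
  have "(\<Sum>t=1..T. M.expectation (\<lambda>\<omega>. r t \<omega> * ((norm (d t \<omega>))\<^sup>2 * (1 / b t \<omega>)\<^sup>2)))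
      = M.expectation (\<lambda>\<omega>. \<Sum>t=1..T. r t \<omega> * ((norm (d t \<omega>))\<^sup>2 * (1 / b t \<omega>)\<^sup>2))"
    by (intro Bochner_Integration.integral_sum[symmetric] integrable_step_term)
  also have "\<dots> \<le> M.expectation (\<lambda>\<omega>. K powr (- p) * dir_sum \<omega> + K powr (1 - 2 * p) * ell)"
  proof (rule integral_mono_AE)
    show "AE \<omega> in M. (\<Sum>t=1..T. r t \<omega> * ((norm (d t \<omega>))\<^sup>2 * (1 / b t \<omega>)\<^sup>2))
        \<le> K powr (- p) * dir_sum \<omega> + K powr (1 - 2 * p) * ell"
      using AE_tame
    proof eventually_elim
      case (elim \<omega>)
      have "K powr (1 - 2 * p) * (ln (y T \<omega>) - ln (y 0 \<omega>)) \<le> K powr (1 - 2 * p) * ell"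
        using ln_y_ratio_le[OF elim] by (intro mult_left_mono) auto
      with sum_step_terms_le[OF tame_space[OF elim] K] show ?case by linarith
    qed
  qed (auto intro!: Bochner_Integration.integrable_sum integrable_step_term integrable_dir_sum
      Bochner_Integration.integrable_add integrable_mult_right simp del: One_nat_def)
  also have "\<dots> = K powr (- p) * M.expectation dir_sum + K powr (1 - 2 * p) * ell"
    using integrable_dir_sum by (simp add: M.prob_space)
  finally have 1: "(\<Sum>t=1..T. M.expectation (\<lambda>\<omega>. r t \<omega> * ((norm (d t \<omega>))\<^sup>2 * (1 / b t \<omega>)\<^sup>2)))
      \<le> K powr (- p) * M.expectation dir_sum + K powr (1 - 2 * p) * ell" .
  have "(\<Sum>t=1..T. M.expectation (\<lambda>\<omega>. (norm (g (Suc t) \<omega>))\<^sup>2 / S t \<omega>))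
      = M.expectation (\<lambda>\<omega>. \<Sum>t=1..T. (norm (g (Suc t) \<omega>))\<^sup>2 / S t \<omega>)"
    by (intro Bochner_Integration.integral_sum[symmetric] integrable_g_term)
  also have "\<dots> \<le> M.expectation (\<lambda>\<omega>. a0\<^sup>2 * (1 + R) * ln (1 + R * real (Suc T)))"
  proof (rule integral_mono_AE)
    show "AE \<omega> in M. (\<Sum>t=1..T. (norm (g (Suc t) \<omega>))\<^sup>2 / S t \<omega>) \<le> a0\<^sup>2 * (1 + R) * ln (1 + R * real (Suc T))"
      using AE_tame
    proof eventually_elim
      case (elim \<omega>)
      have "ln (S (Suc T) \<omega>) \<le> ln (1 + R * real (Suc T))"
        using S_le[OF elim, of "Suc T"] S_ge_1[of "Suc T" \<omega>] R_nonneg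
        by (subst ln_le_cancel_iff) (auto intro: add_pos_nonneg)
      then have "a0\<^sup>2 * (1 + R) * ln (S (Suc T) \<omega>) \<le> a0\<^sup>2 * (1 + R) * ln (1 + R * real (Suc T))"
        using R_nonneg by (intro mult_left_mono) auto
      with sum_g_sq_over_S_le[OF elim, of T] show ?case by linarith
    qed
  qed (auto intro!: Bochner_Integration.integrable_sum integrable_g_term simp del: One_nat_def)
  also have "\<dots> = a0\<^sup>2 * (1 + R) * ln (1 + R * real (Suc T))"
    by (simp add: M.prob_space)
  finally have 2: "(\<Sum>t=1..T. M.expectation (\<lambda>\<omega>. (norm (g (Suc t) \<omega>))\<^sup>2 / S t \<omega>))
      \<le> a0\<^sup>2 * (1 + R) * ln (1 + R * real (Suc T))" .
  have 3: "0 \<le> M.expectation (\<lambda>\<omega>. (r T \<omega> + R) * (norm (e (Suc T) \<omega>))\<^sup>2)"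
    using r_ge_1[of T] R_nonneg
    by (intro Bochner_Integration.integral_nonneg mult_nonneg_nonneg) (auto intro: order.trans[OF zero_le_one] add_nonneg_nonneg)
  have "M.expectation err_sum = (\<Sum>t=1..T. M.expectation (\<lambda>\<omega>. (norm (e t \<omega>))\<^sup>2 / r t \<omega>))"
    unfolding err_sum_def by (intro Bochner_Integration.integral_sum integrable_err_term)
  also have "\<dots> \<le> (1 + R) * (4 * G\<^sup>2) + (1 + R) *
      (2 * \<beta>\<^sup>2 * \<eta>\<^sup>2 * (\<Sum>t=1..T. M.expectation (\<lambda>\<omega>. r t \<omega> * ((norm (d t \<omega>))\<^sup>2 * (1 / b t \<omega>)\<^sup>2)))
       + 2 * (\<Sum>t=1..T. M.expectation (\<lambda>\<omega>. (norm (g (Suc t) \<omega>))\<^sup>2 / S t \<omega>)))"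
    using summed_error_recursion[of T] 3 by linarith
  also have "\<dots> \<le> (1 + R) * (4 * G\<^sup>2) + (1 + R) *
      (2 * \<beta>\<^sup>2 * \<eta>\<^sup>2 * (K powr (- p) * M.expectation dir_sum + K powr (1 - 2 * p) * ell)
       + 2 * (a0\<^sup>2 * (1 + R) * ln (1 + R * real (Suc T))))"
    using 1 2 R_nonneg by (intro add_mono mult_left_mono order.refl) auto
  finally show ?thesis by (simp add: log_const_def power2_eq_square algebra_simps)
qed

text \<open>With k = \<open>K powr p\<close>, each of P and k Q is bounded by a multiple of the
  other plus U-type terms. The factor 3 in k makes the feedback coefficient
  \<open>2 / (9 * (1 + R))\<close>, at most 2/9, so the loop gain is at most 4/9. It also gives
  \<open>2 * \<beta> * \<eta> \<le> k\<close>, which the descent bound requires.\<close>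

lemma expected_sums_le:
  assumes K: "K > 0" "K powr p = 3 * (1 + R) * \<eta> * \<beta>"
  defines "U \<equiv> log_const + K powr p * (objective D f x1 - optimal_value D f) / \<eta> + K * ell"
  shows "M.expectation err_sum \<le> 2 * U" and "K powr p * M.expectation dir_sum \<le> 8 * U"
proof -
  define k P Q W \<rho> \<Delta> where "k = K powr p" and "P = M.expectation err_sum" and "Q = M.expectation dir_sum"
    and "W = K powr p * (objective D f x1 - optimal_value D f) / \<eta>" and "\<rho> = 1 + R"
    and "\<Delta> = objective D f x1 - optimal_value D f"
  have \<rho>: "\<rho> \<ge> 1" using R_nonneg by (simp add: \<rho>_def)
  have k: "k > 0" unfolding k_def using K(1) by simp
  have \<Delta>: "\<Delta> \<ge> 0"
    unfolding \<Delta>_def optimal_value_def using bounded_below by (simp add: cINF_lower)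
  have W: "W \<ge> 0" using \<Delta> k \<eta> by (simp add: W_def \<Delta>_def)
  have "2 * (\<beta> * \<eta>) \<le> 3 * \<rho> * (\<beta> * \<eta>)" using \<rho> \<beta> \<eta> by (intro mult_right_mono) auto
  then have K2: "2 * (\<beta> * \<eta>) \<le> K powr p" using K by (simp add: \<rho>_def mult_ac)
  have powers: "K powr (- p) = 1 / k" "K powr (1 - 2 * p) = K / k\<^sup>2" "K powr (1 - p) = K / k"
    using K(1) powr_diff[of K 1 p] powr_diff[of K 1 "2 * p"] powr_add[of K p p]
    by (auto simp: k_def powr_minus_divide power2_eq_square)
  have "dir_sum \<omega> \<le> 4 * \<Delta> / \<eta> + 2 * K powr (- p) * err_sum \<omega> + 3 * K powr (1 - p) * ell"
    if "tame \<omega>" for \<omega>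
  proof -
    have "3 * K powr (1 - p) * (ln (y T \<omega>) - ln (y 0 \<omega>)) \<le> 3 * K powr (1 - p) * ell"
      using ln_y_ratio_le[OF that] by (intro mult_left_mono) auto
    with dir_sum_le[OF tame_space[OF that] K(1) K2] show ?thesis unfolding \<Delta>_def by linarith
  qed
  then have "Q \<le> M.expectation (\<lambda>\<omega>. 4 * \<Delta> / \<eta> + 2 * K powr (- p) * err_sum \<omega> + 3 * K powr (1 - p) * ell)"
    unfolding Q_def using AE_tame integrable_dir_sum integrable_err_sum
    by (intro integral_mono_AE) (auto elim: eventually_mono)
  also have "\<dots> = 4 * \<Delta> / \<eta> + 2 * K powr (- p) * P + 3 * K powr (1 - p) * ell"
    using integrable_err_sum by (simp add: P_def M.prob_space)
  finally have "k * Q \<le> k * (4 * \<Delta> / \<eta> + 2 * K powr (- p) * P + 3 * K powr (1 - p) * ell)"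
    using k by (intro mult_left_mono) auto
  also have "\<dots> = 4 * W + 2 * P + 3 * (K * ell)"
    unfolding powers using k by (simp add: W_def \<Delta>_def k_def[symmetric] algebra_simps)
  finally have Q: "k * Q \<le> 4 * W + 2 * P + 3 * (K * ell)" .
  have "P \<le> log_const + 2 * \<rho> * \<beta>\<^sup>2 * \<eta>\<^sup>2 * (1 / k * Q + K / k\<^sup>2 * ell)"
    using expected_err_sum_le[OF K(1)] unfolding powers P_def Q_def \<rho>_def by simp
  also have "2 * \<rho> * \<beta>\<^sup>2 * \<eta>\<^sup>2 = 2 / (9 * \<rho>) * k\<^sup>2"
    unfolding k_def K(2) \<rho>_def[symmetric] using \<rho> by (simp add: power2_eq_square)
  also have "2 / (9 * \<rho>) * k\<^sup>2 * (1 / k * Q + K / k\<^sup>2 * ell) = 2 / (9 * \<rho>) * (k * Q + K * ell)"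
  proof -
    have "k\<^sup>2 * (1 / k * Q + K / k\<^sup>2 * ell) = k * Q + K * ell"
      using k by (simp add: distrib_left power2_eq_square)
    then show ?thesis by (simp only: mult.assoc)
  qed
  also have "\<dots> \<le> 2 / 9 * (k * Q + K * ell)"
  proof (rule mult_right_mono)
    have "M.expectation dir_sum \<ge> 0"
      by (intro Bochner_Integration.integral_nonneg dir_sum_nonneg)
    then show "0 \<le> k * Q + K * ell" using k K ell_nonneg by (simp add: Q_def)
  qed (use \<rho> in \<open>simp add: field_simps\<close>)
  finally have P: "P \<le> log_const + 2 / 9 * (k * Q + K * ell)" by simp
  have "K * ell \<ge> 0" using K ell_nonneg by simp
  \<comment> \<open>Eliminating v leaves (5/9) u <= c + (8/9) (w + z), whence the factor 2;
    substituting back gives the factor 8.\<close>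
  moreover have "u \<le> 2 * (c + w + z) \<and> v \<le> 8 * (c + w + z)"
    if "u \<le> c + 2 / 9 * (v + z)" "v \<le> 4 * w + 2 * u + 3 * z" "0 \<le> w" "0 \<le> c" "0 \<le> z" for u v w z c :: real
    using that by (simp add: field_simps)
  ultimately have "P \<le> 2 * U \<and> k * Q \<le> 8 * U"
    unfolding U_def W_def[symmetric] using P Q W log_const_nonneg by blast
  then show "M.expectation err_sum \<le> 2 * U" "K powr p * M.expectation dir_sum \<le> 8 * U"
    by (simp_all add: P_def Q_def k_def)
qed

end

section \<open>Moments of the gradients\<close>

lemma powr_add_le_twice:
  fixes u v c :: real
  assumes "u \<ge> 0" "v \<ge> 0" "0 \<le> c" "c \<le> 1"
  shows "(u + v) powr c \<le> 2 * (u powr c + v powr c)"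
proof -
  have "(u + v) powr c \<le> (2 * max u v) powr c"
    using assms by (intro powr_mono2) auto
  also have "\<dots> = 2 powr c * max u v powr c" using assms by (simp add: powr_mult)
  also have "\<dots> \<le> 2 powr 1 * (u powr c + v powr c)"
    using assms by (intro mult_mono powr_mono) (auto simp: max_def)
  finally show ?thesis by simp
qed

text \<open>Jensen's inequality for a concave power, obtained by summing the tangent at the mean
  z.\<close>

lemma sum_powr_le_mean_powr:
  fixes u :: "'i \<Rightarrow> real"
  assumes "finite I" "\<And>i. i \<in> I \<Longrightarrow> u i \<ge> 0" "0 \<le> c" "c \<le> 1"
  shows "(\<Sum>i\<in>I. u i powr c) \<le> real (card I) * (sum u I / real (card I)) powr c"
proof (cases "sum u I = 0")
  case True
  then have "u i = 0" if "i \<in> I" for i using that assms sum_nonneg_eq_0_iff[of I u] by auto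
  then show ?thesis by simp
next
  case False
  define z where "z = sum u I / real (card I)"
  have n: "card I > 0" using False assms by (auto simp: card_gt_0_iff)
  have z: "z > 0" using False n sum_nonneg[of I u] assms by (simp add: z_def order_less_le)
  have "u i powr c \<le> z powr c * (c * (u i / z) + (1 - c))" if "i \<in> I" for i
  proof -
    have "u i powr c = z powr c * ((u i / z) powr c * 1 powr 0)"
      using assms z that by (simp add: powr_divide)
    also have "\<dots> \<le> z powr c * (c * (u i / z) + 0 * 1 + (1 - c - 0))"
      using assms z that by (intro mult_left_mono powr_mult_le_affine) auto
    finally show ?thesis by simp
  qed
  then have "(\<Sum>i\<in>I. u i powr c) \<le> (\<Sum>i\<in>I. z powr c * (c * (u i / z) + (1 - c)))"
    by (rule sum_mono)
  also have "\<dots> = z powr c * (c * (sum u I / z) + real (card I) * (1 - c))"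
    by (simp add: sum.distrib flip: sum_distrib_left sum_divide_distrib)
  also have "sum u I / z = real (card I)" using n False by (simp add: z_def)
  finally show ?thesis by (simp add: z_def algebra_simps)
qed

section \<open>From the two sums to moments of the gradients\<close>

context storm_run
begin

definition grad_sum :: "'w \<Rightarrow> real" where
  "grad_sum \<omega> = (\<Sum>t=1..T. (norm (grad_obj (x t \<omega>)))\<^sup>2)"

definition phat :: real where "phat = 2 * (1 - p) / 3"

lemma phat: "0 < phat" "phat \<le> 2 / 3" "phat \<le> 1"
  using p by (auto simp: phat_def)

lemma grad_sum_nonneg: "grad_sum \<omega> \<ge> 0"
  by (simp add: grad_sum_def sum_nonneg)

lemma grad_sum_le_max: "grad_sum \<omega> \<le> G\<^sup>2 * real T"
proof -
  have "grad_sum \<omega> \<le> (\<Sum>t=1..T. G\<^sup>2)"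
    unfolding grad_sum_def by (intro sum_mono power_mono norm_grad_obj_le) auto
  then show ?thesis by (simp add: mult.commute)
qed

lemma measurable_grad_sum [measurable]: "grad_sum \<in> borel_measurable M"
  unfolding grad_sum_def
  by (intro borel_measurable_sum borel_measurable_power measurable_compose[OF _ borel_measurable_norm]
      measurable_compose[OF _ measurable_grad_obj] measurable_x) auto

lemma AE_bounded_grad_sum: "AE_bounded M grad_sum"
  using grad_sum_le_max grad_sum_nonneg by (intro AE_boundedI[where C = "G\<^sup>2 * real T"]) auto

lemma integrable_grad_sum: "integrable M grad_sum"
  by (intro M.integrable_AE_bounded AE_bounded_grad_sum) measurable

lemma integrable_grad_sum_powr: "integrable M (\<lambda>\<omega>. grad_sum \<omega> powr phat)"
  using grad_sum_le_max grad_sum_nonneg phat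
  by (intro M.integrable_const_bound[where B = "(G\<^sup>2 * real T) powr phat"] AE_I2)
     (auto intro: powr_mono2)

text \<open>The contribution of the offset \<open>b0 powr (1 / p)\<close> of y to the quotient
  \<open>y T / b T\<close>, where \<open>b T \<ge> b0\<close>.\<close>

definition dir_const :: real where "dir_const = b0 powr (1 / p) / b0"

lemma dir_const_pos: "dir_const > 0" using b0 by (simp add: dir_const_def)

text \<open>Since b is nondecreasing in t, \<open>y T / b T\<close> is at most
  \<open>dir_const + dir_sum\<close>. The same quotient equals
  \<open>(y T / r T) powr (1 - p)\<close>, and taking the root isolates \<open>y T\<close>.\<close>

lemma y_T_le:
  assumes \<omega>: "\<omega> \<in> space M" and T: "1 \<le> T"
  shows "y T \<omega> \<le> (dir_const + dir_sum \<omega>) powr (1 / (1 - p)) * r T \<omega>"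
proof -
  have TT: "T \<in> {1..T}" using T by simp
  have b: "b T \<omega> > 0" "b T \<omega> \<ge> b0" using b_ge[OF \<omega> TT] b0 by auto
  have r: "r T \<omega> > 0" using r_ge_1[of T \<omega>] by simp
  have "(\<Sum>t=1..T. (norm (d t \<omega>))\<^sup>2 / b T \<omega>) \<le> dir_sum \<omega>"
    unfolding dir_sum_def
  proof (rule sum_mono)
    fix t assume t: "t \<in> {1..T}"
    then have "b t \<omega> \<le> b T \<omega>" "0 < b t \<omega>" using b_mono[OF \<omega>, of t T] b_ge[OF \<omega> t] b0 TT by auto
    then show "(norm (d t \<omega>))\<^sup>2 / b T \<omega> \<le> (norm (d t \<omega>))\<^sup>2 / b t \<omega>" by (intro divide_left_mono) auto
  qed
  moreover have "b0 powr (1 / p) / b T \<omega> \<le> dir_const"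
    unfolding dir_const_def using b b0 by (intro divide_left_mono) auto
  ultimately have "y T \<omega> / b T \<omega> \<le> dir_const + dir_sum \<omega>"
    by (simp add: y_def add_divide_distrib sum_divide_distrib)
  moreover have "y T \<omega> / b T \<omega> = (y T \<omega> / r T \<omega>) powr (1 - p)"
  proof -
    have "y T \<omega> / b T \<omega> = (y T \<omega> powr p * y T \<omega> powr (1 - p)) / (y T \<omega> powr p * r T \<omega> powr (1 - p))"
      using y_pos[of T \<omega>] b_eq[OF \<omega> TT] by (simp flip: powr_add)
    then show ?thesis using y_pos[of T \<omega>] r by (simp add: powr_divide)
  qed
  ultimately have "((y T \<omega> / r T \<omega>) powr (1 - p)) powr (1 / (1 - p)) \<le> (dir_const + dir_sum \<omega>) powr (1 / (1 - p))"
    using p by (intro powr_mono2) auto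
  then have "y T \<omega> / r T \<omega> \<le> (dir_const + dir_sum \<omega>) powr (1 / (1 - p))"
    using p r y_pos[of T \<omega>] by (simp add: powr_powr)
  then show ?thesis using r by (simp add: pos_divide_le_eq)
qed

lemma grad_sum_le:
  assumes \<omega>: "\<omega> \<in> space M" and T: "1 \<le> T"
  shows "grad_sum \<omega> \<le> 2 * (((dir_const + dir_sum \<omega>) powr (1 / (1 - p)) + err_sum \<omega>) * r T \<omega>)"
proof -
  have "(norm (grad_obj (x t \<omega>)))\<^sup>2 \<le> 2 * (norm (d t \<omega>))\<^sup>2 + 2 * (norm (e t \<omega>))\<^sup>2" for t
  proof -
    have "norm (grad_obj (x t \<omega>)) \<le> norm (d t \<omega>) + norm (e t \<omega>)"
      using norm_triangle_ineq4[of "d t \<omega>" "e t \<omega>"] by (simp add: e_def)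
    then have "(norm (grad_obj (x t \<omega>)))\<^sup>2 \<le> (norm (d t \<omega>) + norm (e t \<omega>))\<^sup>2" by (simp add: power_mono)
    also have "\<dots> \<le> 2 * (norm (d t \<omega>))\<^sup>2 + 2 * (norm (e t \<omega>))\<^sup>2" by (rule power2_add_le)
    finally show ?thesis .
  qed
  then have "grad_sum \<omega> \<le> (\<Sum>t=1..T. 2 * (norm (d t \<omega>))\<^sup>2 + 2 * (norm (e t \<omega>))\<^sup>2)"
    unfolding grad_sum_def by (intro sum_mono)
  also have "\<dots> = 2 * (\<Sum>t=1..T. (norm (d t \<omega>))\<^sup>2) + 2 * (\<Sum>t=1..T. (norm (e t \<omega>))\<^sup>2)"
    by (simp add: sum.distrib sum_distrib_left)
  also have "(\<Sum>t=1..T. (norm (d t \<omega>))\<^sup>2) \<le> (dir_const + dir_sum \<omega>) powr (1 / (1 - p)) * r T \<omega>"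
    using y_T_le[OF assms] powr_ge_zero[of b0 "1 / p"] unfolding y_def by linarith
  also have "(\<Sum>t=1..T. (norm (e t \<omega>))\<^sup>2) \<le> err_sum \<omega> * r T \<omega>"
    unfolding err_sum_def sum_distrib_right
  proof (rule sum_mono)
    fix t assume t: "t \<in> {1..T}"
    have "(norm (e t \<omega>))\<^sup>2 = (norm (e t \<omega>))\<^sup>2 / r t \<omega> * r t \<omega>" using r_ge_1[of t \<omega>] by simp
    also have "\<dots> \<le> (norm (e t \<omega>))\<^sup>2 / r t \<omega> * r T \<omega>"
      using r_mono_le[of t T \<omega>] t r_ge_1[of t \<omega>] by (intro mult_left_mono) auto
    finally show "(norm (e t \<omega>))\<^sup>2 \<le> (norm (e t \<omega>))\<^sup>2 / r t \<omega> * r T \<omega>" .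
  qed
  finally show ?thesis by (simp add: algebra_simps)
qed

lemma grad_sum_powr_le:
  assumes \<omega>: "\<omega> \<in> space M" and T: "1 \<le> T"
  shows "grad_sum \<omega> powr phat \<le> 4 * ((dir_const + dir_sum \<omega>) powr (2 / 3) * S T \<omega> powr (phat / 3)
    + err_sum \<omega> powr phat * S T \<omega> powr (phat / 3))"
proof -
  let ?u = "(dir_const + dir_sum \<omega>) powr (1 / (1 - p))" and ?v = "err_sum \<omega>"
  have r: "r T \<omega> > 0" using r_ge_1[of T \<omega>] by simp
  have "grad_sum \<omega> powr phat \<le> (2 * ((?u + ?v) * r T \<omega>)) powr phat"
    using grad_sum_le[OF assms] grad_sum_nonneg phat by (intro powr_mono2) auto
  also have "\<dots> = 2 powr phat * ((?u + ?v) powr phat * r T \<omega> powr phat)"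
    using r err_sum_nonneg[of \<omega>] by (simp add: powr_mult)
  also have "\<dots> \<le> 2 powr 1 * ((2 * (?u powr phat + ?v powr phat)) * r T \<omega> powr phat)"
    using phat err_sum_nonneg[of \<omega>]
    by (intro mult_mono[OF powr_mono mult_right_mono[OF powr_add_le_twice]]) auto
  \<comment> \<open>The root \<open>1 / (1 - p)\<close> and phat combine to an exponent that no
    longer depends on p.\<close>
  also have "?u powr phat = (dir_const + dir_sum \<omega>) powr (2 / 3)"
  proof -
    have "1 / (1 - p) * phat = 2 / 3" using p by (simp add: phat_def field_simps)
    then show ?thesis by (simp only: powr_powr)
  qed
  also have "r T \<omega> powr phat = S T \<omega> powr (phat / 3)"
    by (simp add: r_def powr_powr)
  finally show ?thesis by (simp add: algebra_simps)
qed

lemma integrable_S: "T0 \<le> Suc T \<Longrightarrow> integrable M (S T0)"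
  by (intro M.integrable_AE_bounded AE_bounded_S measurable_S)

text \<open>Hoelder's inequality for both products in \<open>grad_sum_powr_le\<close>; the exponents
  sum to less than 1 as phat is at most 2/3. The bound m on the mean of \<open>S T\<close> stays
  free because the lemma is used with a crude and then with a sharp value.\<close>

lemma expected_grad_sum_powr_le:
  assumes T: "1 \<le> T" and K: "K > 0" "K powr p = 3 * (1 + R) * \<eta> * \<beta>"
    and V: "V > 0" "log_const + K powr p * (objective D f x1 - optimal_value D f) / \<eta> + K * ell \<le> V"
      "K powr p * dir_const \<le> V"
    and m: "m > 0" "M.expectation (S T) \<le> m"
  shows "M.expectation (\<lambda>\<omega>. grad_sum \<omega> powr phat)
    \<le> 4 * ((9 * V / K powr p) powr (2 / 3) + (2 * V) powr phat) * m powr (phat / 3)"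
proof -
  have k: "K powr p > 0" using K(1) by simp
  note sums = expected_sums_le[OF K]
  have X: "M.expectation (\<lambda>\<omega>. dir_const + dir_sum \<omega>) \<le> 9 * V / K powr p"
  proof -
    \<comment> \<open>8 V for \<open>dir_sum\<close> and V for \<open>dir_const\<close>.\<close>
    have "K powr p * (dir_const + M.expectation dir_sum) \<le> 9 * V"
      using sums(2) V by (simp add: distrib_left)
    then have "dir_const + M.expectation dir_sum \<le> 9 * V / K powr p"
      using k by (simp add: pos_le_divide_eq mult.commute)
    then show ?thesis using integrable_dir_sum by (simp add: M.prob_space)
  qed
  have Y: "M.expectation err_sum \<le> 2 * V" using sums(1) V by simp
  have iX: "integrable M (\<lambda>\<omega>. dir_const + dir_sum \<omega>)" using integrable_dir_sum by simp
  have iS: "integrable M (S T)" by (rule integrable_S) simp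
  have nn: "0 \<le> dir_const + dir_sum \<omega>" "0 \<le> err_sum \<omega>" "0 \<le> S T \<omega>" if "\<omega> \<in> space M" for \<omega>
    using dir_sum_nonneg[OF that] dir_const_pos err_sum_nonneg[of \<omega>] S_ge_1[of T \<omega>] by auto
  note H1 = M.expectation_powr_mult_le[OF iX iS nn(1,3) X m(2) _ m(1), of "2 / 3" "phat / 3"]
  note H2 = M.expectation_powr_mult_le[OF integrable_err_sum iS nn(2,3) Y m(2) _ m(1), of phat "phat / 3"]
  have ph: "2 / 3 + phat / 3 \<le> 1" "phat + phat / 3 \<le> 1" "0 \<le> phat / 3"
    using phat by auto
  have "M.expectation (\<lambda>\<omega>. grad_sum \<omega> powr phat)
    \<le> M.expectation (\<lambda>\<omega>. 4 * ((dir_const + dir_sum \<omega>) powr (2 / 3) * S T \<omega> powr (phat / 3)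
      + err_sum \<omega> powr phat * S T \<omega> powr (phat / 3)))"
    using H1(1) H2(1) V k ph phat
    by (intro integral_mono integrable_grad_sum_powr grad_sum_powr_le[OF _ T]) auto
  also have "\<dots> = 4 * (M.expectation (\<lambda>\<omega>. (dir_const + dir_sum \<omega>) powr (2 / 3) * S T \<omega> powr (phat / 3))
      + M.expectation (\<lambda>\<omega>. err_sum \<omega> powr phat * S T \<omega> powr (phat / 3)))"
    using H1(1) H2(1) V k ph phat by simp
  also have "\<dots> \<le> 4 * ((9 * V / K powr p) powr (2 / 3) * m powr (phat / 3) + (2 * V) powr phat * m powr (phat / 3))"
    using H1(2) H2(2) V k ph phat by (intro mult_left_mono add_mono) auto
  finally show ?thesis by (simp add: algebra_simps)
qed

text \<open>The point \<open>x t\<close> is determined by the first t - 1 samples, so freezing the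
  past bounds the mean of the squared gradient at sample t by variance plus squared true
  gradient.\<close>

lemma expected_S_le: "M.expectation (S T) \<le> 1 + (\<sigma>\<^sup>2 * real T + M.expectation grad_sum) / a0\<^sup>2"
proof -
  have int_g: "integrable M (\<lambda>\<omega>. (norm (g t \<omega>))\<^sup>2)" if "t \<in> {1..T}" for t
    using that by (intro M.integrable_AE_bounded AE_bounded_intros AE_bounded_process borel_measurable_power
        measurable_compose[OF _ borel_measurable_norm] measurable_process) auto
  have int_F: "integrable M (\<lambda>\<omega>. (norm (grad_obj (x t \<omega>)))\<^sup>2)" if "t \<in> {1..T}" for t
    using that by (intro M.integrable_AE_bounded AE_bounded_intros AE_bounded_grad_obj borel_measurable_power
        measurable_compose[OF _ borel_measurable_norm] measurable_compose[OF _ measurable_grad_obj] measurable_x) auto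
  have "M.expectation (\<lambda>\<omega>. (norm (g t \<omega>))\<^sup>2) \<le> \<sigma>\<^sup>2 + M.expectation (\<lambda>\<omega>. (norm (grad_obj (x t \<omega>)))\<^sup>2)"
    if t: "t \<in> {1..T}" for t
  proof -
    define n where "n = t - 1"
    have n: "t = Suc n" using t by (simp add: n_def)
    define h where "h = (\<lambda>(\<omega>, s). (norm (stoch_grad f (x t \<omega>) s))\<^sup>2)"
    have [measurable]: "x t \<in> borel_measurable (F n)"
      using t by (intro measurable_x_F) (auto simp: n_def)
    have [measurable]: "(\<lambda>z. stoch_grad f (x t (fst z)) (snd z)) \<in> borel_measurable (F n \<Otimes>\<^sub>M D)"
      by (rule measurable_stoch_grad_comp; measurable)
    have mh: "h \<in> borel_measurable (F n \<Otimes>\<^sub>M D)"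
      unfolding h_def split_beta by measurable
    have ih: "integrable M (\<lambda>\<omega>. h (\<omega>, \<xi> (Suc n) \<omega>))"
      using int_g[OF t] by (simp add: h_def g_def n)
    note cond = M.sample_algebra_expectation[OF indep_samples distr_sample mh ih, simplified]
    have "M.expectation (\<lambda>\<omega>. (norm (g t \<omega>))\<^sup>2) = M.expectation (\<lambda>\<omega>. h (\<omega>, \<xi> (Suc n) \<omega>))"
      by (simp add: h_def g_def n)
    also have "\<dots> = M.expectation (\<lambda>\<omega>. \<integral>s. h (\<omega>, s) \<partial>D)" by (rule cond(2))
    also have "\<dots> \<le> M.expectation (\<lambda>\<omega>. \<sigma>\<^sup>2 + (norm (grad_obj (x t \<omega>)))\<^sup>2)"
      using cond(1) int_F[OF t] second_moment_stoch_grad_le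
      by (intro integral_mono) (auto simp: h_def)
    also have "\<dots> = \<sigma>\<^sup>2 + M.expectation (\<lambda>\<omega>. (norm (grad_obj (x t \<omega>)))\<^sup>2)"
      using int_F[OF t] by (simp add: M.prob_space)
    finally show ?thesis .
  qed
  then have "(\<Sum>t=1..T. M.expectation (\<lambda>\<omega>. (norm (g t \<omega>))\<^sup>2))
      \<le> (\<Sum>t=1..T. \<sigma>\<^sup>2 + M.expectation (\<lambda>\<omega>. (norm (grad_obj (x t \<omega>)))\<^sup>2))"
    by (intro sum_mono)
  also have "\<dots> = \<sigma>\<^sup>2 * real T + M.expectation grad_sum"
    unfolding grad_sum_def using int_F by (subst Bochner_Integration.integral_sum) (auto simp: sum.distrib mult.commute)
  finally have le: "(\<Sum>t=1..T. M.expectation (\<lambda>\<omega>. (norm (g t \<omega>))\<^sup>2)) \<le> \<sigma>\<^sup>2 * real T + M.expectation grad_sum" .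
  have "M.expectation (S T) = 1 + (\<Sum>t=1..T. M.expectation (\<lambda>\<omega>. (norm (g t \<omega>))\<^sup>2)) / a0\<^sup>2"
    unfolding S_def using int_g
    by (subst Bochner_Integration.integral_add)
       (auto simp: M.prob_space Bochner_Integration.integral_sum sum_divide_distrib
          intro!: Bochner_Integration.integrable_sum)
  with le show ?thesis using a0 by (simp add: divide_right_mono)
qed

text \<open>\<open>grad_sum\<close> is at most G^2 T on every path, so all but its power phat can be
  bounded by a constant. This converts the moment of order phat into a first moment.\<close>

lemma expected_grad_sum_le: 
  "M.expectation grad_sum \<le> (G\<^sup>2 * real T) powr (1 - phat) * M.expectation (\<lambda>\<omega>. grad_sum \<omega> powr phat)"
proof -
  have "M.expectation grad_sum \<le> M.expectation (\<lambda>\<omega>. (G\<^sup>2 * real T) powr (1 - phat) * grad_sum \<omega> powr phat)"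
  proof (intro integral_mono integrable_grad_sum integrable_mult_right integrable_grad_sum_powr)
    fix \<omega>
    have "grad_sum \<omega> = grad_sum \<omega> powr (1 - phat) * grad_sum \<omega> powr phat"
      using grad_sum_nonneg[of \<omega>] by (simp flip: powr_add)
    also have "\<dots> \<le> (G\<^sup>2 * real T) powr (1 - phat) * grad_sum \<omega> powr phat"
      using grad_sum_nonneg grad_sum_le_max phat by (intro mult_right_mono powr_mono2) auto
    finally show "grad_sum \<omega> \<le> (G\<^sup>2 * real T) powr (1 - phat) * grad_sum \<omega> powr phat" .
  qed
  then show ?thesis by simp
qed

text \<open>The bootstrap. \<open>core\<close> is applied first with m = \<open>(1 + R) * T\<close>;
  by \<open>boot\<close> this makes the mean of \<open>grad_sum\<close> at most
  \<open>\<sigma>^2 * T\<close>, so that \<open>expected_S_le\<close> permits m =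
  \<open>(1 + 2 / a0^2) * \<sigma>^2 * T\<close> in the second application.\<close>

lemma expected_grad_sum_powr_noise_le:
  assumes T: "1 \<le> T" "1 \<le> ln (real T)" and K: "K > 0" "K powr p = 3 * (1 + R) * \<eta> * \<beta>" and c: "c \<ge> 1"
    and V: "log_const + K powr p * (objective D f x1 - optimal_value D f) / \<eta> + K * ell \<le> c * ln (real T) * K"
      "K powr p * dir_const \<le> c * ln (real T) * K"
    and \<sigma>: "1 \<le> \<sigma>\<^sup>2 * real T"
    and boot: "(G\<^sup>2 * real T) powr (1 - phat) *
        (44 * (c * ln (real T)) powr (2 / 3) * K powr phat * ((1 + R) * real T) powr (phat / 3)) \<le> \<sigma>\<^sup>2 * real T"
  shows "M.expectation (\<lambda>\<omega>. grad_sum \<omega> powr phat)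
    \<le> 44 * (c * ln (real T)) powr (2 / 3) * K powr phat * ((1 + 2 / a0\<^sup>2) * (\<sigma>\<^sup>2 * real T)) powr (phat / 3)"
proof -
  define L where "L = c * ln (real T)"
  have L: "L \<ge> 1" unfolding L_def using T c mult_mono[of 1 c 1 "ln (real T)"] by simp
  \<comment> \<open>44 = 4 (9 + 2). Both Hoelder terms scale like \<open>K powr phat\<close>, the
    first because K divided by \<open>K powr p\<close> is raised to 2/3; \<open>L \<ge> 1\<close>
    allows the exponent phat of L to be raised to 2/3.\<close>
  have core: "M.expectation (\<lambda>\<omega>. grad_sum \<omega> powr phat) \<le> 44 * L powr (2 / 3) * K powr phat * m powr (phat / 3)"
    if m: "m > 0" "M.expectation (S T) \<le> m" for m
  proof -
    have LK: "L * K > 0" using L K by simp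
    have "(9 * (L * K) / K powr p) powr (2 / 3) = 9 powr (2 / 3) * (L powr (2 / 3) * (K powr (1 - p)) powr (2 / 3))"
      using L K(1) by (simp add: powr_mult powr_divide powr_diff)
    also have "(K powr (1 - p)) powr (2 / 3) = K powr phat"
      by (simp add: powr_powr phat_def algebra_simps)
    also have "9 powr (2 / 3) * (L powr (2 / 3) * K powr phat) \<le> 9 powr 1 * (L powr (2 / 3) * K powr phat)"
      by (intro mult_right_mono powr_mono) auto
    finally have 1: "(9 * (L * K) / K powr p) powr (2 / 3) \<le> 9 * (L powr (2 / 3) * K powr phat)" by simp
    have "(2 * (L * K)) powr phat = 2 powr phat * (L powr phat * K powr phat)"
      using L K by (simp add: powr_mult)
    also have "\<dots> \<le> 2 powr 1 * (L powr (2 / 3) * K powr phat)"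
      using L phat by (intro mult_mono[OF powr_mono mult_right_mono[OF powr_mono]]) auto
    finally have 2: "(2 * (L * K)) powr phat \<le> 2 * (L powr (2 / 3) * K powr phat)" by simp
    have "M.expectation (\<lambda>\<omega>. grad_sum \<omega> powr phat)
        \<le> 4 * ((9 * (L * K) / K powr p) powr (2 / 3) + (2 * (L * K)) powr phat) * m powr (phat / 3)"
      using V m LK by (intro expected_grad_sum_powr_le T K) (auto simp: L_def)
    also have "\<dots> \<le> 4 * (9 * (L powr (2 / 3) * K powr phat) + 2 * (L powr (2 / 3) * K powr phat)) * m powr (phat / 3)"
      using 1 2 by (intro mult_right_mono mult_left_mono add_mono) auto
    finally show ?thesis by (simp add: algebra_simps)
  qed
  have "M.expectation (S T) \<le> M.expectation (\<lambda>_. (1 + R) * real T)"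
  proof (rule integral_mono_AE)
    show "AE \<omega> in M. S T \<omega> \<le> (1 + R) * real T"
      using AE_tame
    proof eventually_elim
      case (elim \<omega>)
      from S_le[OF elim, of T] T show ?case by (simp add: algebra_simps)
    qed
  qed (auto intro: integrable_S)
  then have "M.expectation (S T) \<le> (1 + R) * real T" by (simp add: M.prob_space)
  then have "M.expectation (\<lambda>\<omega>. grad_sum \<omega> powr phat)
      \<le> 44 * L powr (2 / 3) * K powr phat * ((1 + R) * real T) powr (phat / 3)"
    using T R_nonneg by (intro core) auto
  then have "(G\<^sup>2 * real T) powr (1 - phat) * M.expectation (\<lambda>\<omega>. grad_sum \<omega> powr phat)
      \<le> (G\<^sup>2 * real T) powr (1 - phat) * (44 * L powr (2 / 3) * K powr phat * ((1 + R) * real T) powr (phat / 3))"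
    by (intro mult_left_mono) auto
  with boot expected_grad_sum_le have "M.expectation grad_sum \<le> \<sigma>\<^sup>2 * real T"
    unfolding L_def by linarith
  then have "(\<sigma>\<^sup>2 * real T + M.expectation grad_sum) / a0\<^sup>2 \<le> (\<sigma>\<^sup>2 * real T + \<sigma>\<^sup>2 * real T) / a0\<^sup>2"
    by (intro divide_right_mono add_left_mono) auto
  with expected_S_le have "M.expectation (S T) \<le> 1 + (\<sigma>\<^sup>2 * real T + \<sigma>\<^sup>2 * real T) / a0\<^sup>2"
    by linarith
  also have "\<dots> \<le> \<sigma>\<^sup>2 * real T + (\<sigma>\<^sup>2 * real T + \<sigma>\<^sup>2 * real T) / a0\<^sup>2" using \<sigma> by simp
  also have "\<dots> = (1 + 2 / a0\<^sup>2) * (\<sigma>\<^sup>2 * real T)" by (simp add: algebra_simps add_divide_distrib)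
  finally have "M.expectation (S T) \<le> (1 + 2 / a0\<^sup>2) * (\<sigma>\<^sup>2 * real T)" .
  moreover have "(1 + 2 / a0\<^sup>2) * (\<sigma>\<^sup>2 * real T) > 0"
    using \<sigma> by (intro mult_pos_pos[OF add_pos_nonneg]) auto
  ultimately show ?thesis unfolding L_def[symmetric] by (intro core)
qed

text \<open>The uniform index averages \<open>((norm grad)^2) powr phat\<close> over t, and
  concavity moves the power outside the average.\<close>

lemma output_expectation:
  assumes T: "1 \<le> T"
  shows "integrable (output_space M T) (\<lambda>(\<omega>, t). norm (grad_obj (x t \<omega>)) powr (2 * phat))"
    and "(\<integral>(\<omega>, t). norm (grad_obj (x t \<omega>)) powr (2 * phat) \<partial>output_space M T)
      \<le> M.expectation (\<lambda>\<omega>. grad_sum \<omega> powr phat) / real T powr phat"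
proof -
  define u where "u = (\<lambda>t \<omega>. norm (grad_obj (x t \<omega>)) powr (2 * phat))"
  let ?C = "uniform_count_measure {1..T}"
  interpret C: prob_space ?C using T by (intro prob_space_uniform_count_measure) auto
  interpret MC: pair_prob_space M ?C ..
  have u_alt: "u t \<omega> = ((norm (grad_obj (x t \<omega>)))\<^sup>2) powr phat" for t \<omega>
    by (simp add: u_def flip: powr_powr)
  have mu: "u t \<in> borel_measurable M" if "t \<in> {1..T}" for t
  proof -
    have [measurable]: "(\<lambda>\<omega>. grad_obj (x t \<omega>)) \<in> borel_measurable M"
      by (rule measurable_compose[OF measurable_x measurable_grad_obj]) (use that in auto)
    show ?thesis unfolding u_def by measurable
  qed
  have meas: "(\<lambda>(\<omega>, t). u t \<omega>) \<in> borel_measurable (M \<Otimes>\<^sub>M ?C)"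
  proof -
    \<comment> \<open>Joint measurability: the index takes finitely many values, so the integrand is
      a finite sum of products.\<close>
    have "(\<lambda>z. \<Sum>t=1..T. u t (fst z) * indicator {t} (snd z)) \<in> borel_measurable (M \<Otimes>\<^sub>M ?C)"
    proof (rule borel_measurable_sum, rule borel_measurable_times)
      fix t assume t: "t \<in> {1..T}"
      show "(\<lambda>z. u t (fst z)) \<in> borel_measurable (M \<Otimes>\<^sub>M ?C)"
        by (rule measurable_compose[OF measurable_fst mu[OF t]])
      have "indicator {t} \<in> borel_measurable ?C"
        using t by (intro borel_measurable_indicator) (simp add: sets_uniform_count_measure)
      from measurable_compose[OF measurable_snd this]
      show "(\<lambda>z. indicator {t} (snd z) :: real) \<in> borel_measurable (M \<Otimes>\<^sub>M ?C)" .
    qed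
    moreover have "(\<Sum>t=1..T. u t (fst z) * indicator {t} (snd z)) = (case z of (\<omega>, t) \<Rightarrow> u t \<omega>)"
      if "z \<in> space (M \<Otimes>\<^sub>M ?C)" for z
    proof -
      have "snd z \<in> {1..T}" using that by (auto simp: space_pair_measure space_uniform_count_measure)
      then show ?thesis
        by (subst sum.remove[of _ "snd z"]) (auto simp: split_beta indicator_def intro!: sum.neutral)
    qed
    ultimately show ?thesis by (subst measurable_cong[symmetric]) auto
  qed
  have int: "integrable (M \<Otimes>\<^sub>M ?C) (\<lambda>(\<omega>, t). u t \<omega>)"
  proof (rule MC.integrable_const_bound[where B = "G powr (2 * phat)"])
    show "AE z in M \<Otimes>\<^sub>M ?C. norm (case z of (\<omega>, t) \<Rightarrow> u t \<omega>) \<le> G powr (2 * phat)"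
      using norm_grad_obj_le phat by (intro AE_I2) (auto simp: u_def intro!: powr_mono2)
  qed (rule meas)
  then show "integrable (output_space M T) (\<lambda>(\<omega>, t). norm (grad_obj (x t \<omega>)) powr (2 * phat))"
    by (simp add: output_space_def u_def)
  have iu: "integrable M (\<lambda>\<omega>. \<Sum>t=1..T. u t \<omega>)"
    using norm_grad_obj_le phat
    by (intro Bochner_Integration.integrable_sum M.integrable_const_bound[where B = "G powr (2 * phat)"] mu AE_I2)
       (auto simp: u_def intro!: powr_mono2)
  have "(\<integral>(\<omega>, t). norm (grad_obj (x t \<omega>)) powr (2 * phat) \<partial>output_space M T)
      = (\<integral>\<omega>. (\<integral>t. u t \<omega> \<partial>?C) \<partial>M)"
    using MC.integral_fst'[OF int] by (simp add: output_space_def u_def)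
  also have "\<dots> = (\<integral>\<omega>. (\<Sum>t=1..T. u t \<omega>) / real T \<partial>M)"
    by (simp add: integral_uniform_count_measure)
  also have "\<dots> \<le> (\<integral>\<omega>. grad_sum \<omega> powr phat / real T powr phat \<partial>M)"
  proof (intro integral_mono Bochner_Integration.integrable_divide iu integrable_grad_sum_powr)
    fix \<omega>
    have "(\<Sum>t=1..T. u t \<omega>) \<le> real (card {1..T}) * (grad_sum \<omega> / real (card {1..T})) powr phat"
      unfolding u_alt grad_sum_def using phat by (intro sum_powr_le_mean_powr) auto
    then show "(\<Sum>t=1..T. u t \<omega>) / real T \<le> grad_sum \<omega> powr phat / real T powr phat"
      using T grad_sum_nonneg[of \<omega>] by (simp add: powr_divide pos_divide_le_eq mult.commute)
  qed
  also have "\<dots> = M.expectation (\<lambda>\<omega>. grad_sum \<omega> powr phat) / real T powr phat" by simp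
  finally show "(\<integral>(\<omega>, t). norm (grad_obj (x t \<omega>)) powr (2 * phat) \<partial>output_space M T)
      \<le> M.expectation (\<lambda>\<omega>. grad_sum \<omega> powr phat) / real T powr phat" .
qed


lemma log_const_le:
  assumes "1 \<le> T" "1 \<le> ln (real T)"
  shows "log_const \<le> (4 * (1 + R) * G\<^sup>2 + 2 * a0\<^sup>2 * (1 + R)\<^sup>2 * (ln (1 + 2 * R) + 1)) * ln (real T)"
proof -
  define l where "l = ln (real T)"
  have R: "0 \<le> R" by (rule R_nonneg)
  have "1 + R * real (Suc T) \<le> (1 + 2 * R) * real T"
    using assms R mult_left_mono[of 1 "real T" R] by (simp add: algebra_simps)
  then have "ln (1 + R * real (Suc T)) \<le> ln ((1 + 2 * R) * real T)"
    using R assms by (subst ln_le_cancel_iff) (auto intro: add_pos_nonneg)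
  also have "\<dots> = ln (1 + 2 * R) + l" using R assms by (simp add: ln_mult l_def)
  also have "ln (1 + 2 * R) \<le> ln (1 + 2 * R) * l"
    using R assms mult_left_mono[of 1 l "ln (1 + 2 * R)"] by (simp add: l_def)
  finally have "ln (1 + R * real (Suc T)) \<le> (ln (1 + 2 * R) + 1) * l" by (simp add: algebra_simps)
  then have "2 * a0\<^sup>2 * (1 + R)\<^sup>2 * ln (1 + R * real (Suc T)) \<le> 2 * a0\<^sup>2 * (1 + R)\<^sup>2 * ((ln (1 + 2 * R) + 1) * l)"
    by (intro mult_left_mono) auto
  moreover have "4 * (1 + R) * G\<^sup>2 * 1 \<le> 4 * (1 + R) * G\<^sup>2 * l"
    using R assms by (intro mult_left_mono) (auto simp: l_def)
  ultimately show ?thesis by (simp add: log_const_def distrib_right mult.assoc flip: l_def)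
qed

lemma ell_le:
  assumes "1 \<le> T" "1 \<le> ln (real T)"
  shows "ell \<le> (ln (1 + 4 * G\<^sup>2 / b0 powr (1 / p)) + 3) * ln (real T)"
proof -
  define w where "w = 4 * G\<^sup>2 / b0 powr (1 / p)"
  have w: "w \<ge> 0" by (simp add: w_def)
  have "1 + w * real T ^ 3 \<le> (1 + w) * real T ^ 3"
    using assms by (simp add: algebra_simps)
  then have "ln (1 + w * real T ^ 3) \<le> ln ((1 + w) * real T ^ 3)"
    using w assms by (subst ln_le_cancel_iff) (auto intro: add_pos_nonneg)
  also have "\<dots> = ln (1 + w) + 3 * ln (real T)"
    using w assms by (simp add: ln_mult ln_realpow)
  also have "ln (1 + w) \<le> ln (1 + w) * ln (real T)"
    using w assms mult_left_mono[of 1 "ln (real T)" "ln (1 + w)"] by simp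
  finally show ?thesis by (simp add: ell_def w_def algebra_simps)
qed

end

section \<open>Asymptotics in T and the final bound\<close>

lemma eventually_log_powr_le:
  fixes A C s \<epsilon> :: real
  assumes "A \<ge> 0" "s > 0" "\<epsilon> > 0" "0 \<le> c" "c \<le> 1"
  shows "\<forall>\<^sub>F T in sequentially. A * ln (real T) powr c \<le> \<epsilon> * real T powr s"
proof -
  have "(\<lambda>T. ln (real T) / real T powr s) \<longlonglongrightarrow> 0"
    using assms by (intro lim_ln_over_power) auto
  \<comment> \<open>A + 1 instead of A, since A may be 0.\<close>
  moreover have "\<epsilon> / (A + 1) > 0" using assms by simp
  ultimately have "\<forall>\<^sub>F T in sequentially. ln (real T) / real T powr s < \<epsilon> / (A + 1)"
    by (rule order_tendstoD(2))
  moreover have "\<forall>\<^sub>F T in sequentially. 1 \<le> ln (real T)"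
    using filterlim_compose[OF ln_at_top filterlim_real_sequentially] by (simp add: filterlim_at_top)
  ultimately show ?thesis
    using eventually_gt_at_top[of 0]
  proof eventually_elim
    case (elim T)
    have "A * ln (real T) powr c \<le> (A + 1) * ln (real T) powr 1"
      using elim assms by (intro mult_mono powr_mono) auto
    also have "\<dots> \<le> (A + 1) * (\<epsilon> / (A + 1) * real T powr s)"
      using elim assms by (intro mult_left_mono) (auto simp: pos_divide_less_eq)
    also have "\<dots> = \<epsilon> * real T powr s" using assms by simp
    finally show ?case .
  qed
qed

theorem theoremG3:
  fixes a0 b0 \<eta> p q phat G \<beta>0 :: real
  assumes "a0 > 0" and "b0 > 0" and "\<eta> > 0"
    and "1 / 4 \<le> p" and "p \<le> 1 / 2" and "p + 2 * q = 1"
    and "phat = 2 * (1 - p) / 3"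
    and "G \<ge> 0" and "\<beta>0 > 0"
  shows "\<exists>C. \<forall>\<beta> \<sigma> \<Delta>. \<beta> \<ge> \<beta>0 \<longrightarrow> \<sigma> \<ge> 0 \<longrightarrow> \<sigma> \<noteq> 0 \<longrightarrow>
    (\<exists>T0. \<forall>(D :: 's measure) (f :: 'a::euclidean_space \<Rightarrow> 's \<Rightarrow> real) x1
        (M :: 'w measure) \<xi> T x d a b.
      stochastic_problem D f \<sigma> \<beta> G \<longrightarrow>
      objective D f x1 - optimal_value D f = \<Delta> \<longrightarrow>
      iid_samples M D \<xi> \<longrightarrow>
      (\<forall>\<omega>\<in>space M. meta_storm_sg a0 b0 \<eta> p q f x1 T (\<lambda>t. \<xi> t \<omega>)
         (\<lambda>t. x t \<omega>) (\<lambda>t. d t \<omega>) (\<lambda>t. a t \<omega>) (\<lambda>t. b t \<omega>)) \<longrightarrow>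
      T \<ge> T0 \<longrightarrow>
      integrable (output_space M T)
        (\<lambda>(\<omega>, t). norm (gradient (objective D f) (x t \<omega>)) powr (2 * phat)) \<and>
      (\<integral>(\<omega>, t). norm (gradient (objective D f) (x t \<omega>)) powr (2 * phat) \<partial>output_space M T)
        \<le> C * (\<Delta> powr (phat / (1 - p))
               + \<beta> powr (phat / p) * pos_ln \<beta> powr (phat / (1 - p))
               + \<beta> powr (phat / p) * ln (1 + \<sigma>\<^sup>2 * real T) powr (phat / (1 - p)))
            * (1 / real T powr phat + \<sigma> powr (2 * phat / 3) / real T powr (2 * phat / 3)))"
proof -
  define \<rho> where "\<rho> = 1 + G\<^sup>2 / a0\<^sup>2"
  define Kf where "Kf = (\<lambda>\<beta>. (3 * \<rho> * \<eta> * \<beta>) powr (1 / p))"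
  define c1 where "c1 = 4 * \<rho> * G\<^sup>2 + 2 * a0\<^sup>2 * \<rho>\<^sup>2 * (ln (1 + 2 * (G\<^sup>2 / a0\<^sup>2)) + 1)"
  define c2 where "c2 = ln (1 + 4 * G\<^sup>2 / b0 powr (1 / p)) + 3"
  \<comment> \<open>Three shares of \<open>c * ln T * K\<close>: \<open>log_const\<close> uses the
    first (as \<open>Kf \<beta>0 \<le> K\<close>), \<open>K * ell\<close> the second, and the term
    with \<open>\<Delta>\<close> the third.\<close>
  define c where "c = c1 / Kf \<beta>0 + c2 + 1"
  \<comment> \<open>The 2 beside c pays for replacing ln T by twice the logarithm of
    \<open>1 + \<sigma>^2 * T\<close>; the factor with exponent \<open>phat / p\<close> is
    \<open>K powr phat\<close> without its power of \<open>\<beta>\<close>.\<close>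
  define C where "C = 44 * (2 * c) powr (2 / 3) * (3 * \<rho> * \<eta>) powr (phat / p) * (1 + 2 / a0\<^sup>2) powr (phat / 3)"
  have p: "0 < p" "p \<le> 1 / 2" using assms by auto
  have phat: "0 < phat" "phat \<le> 1" "phat / (1 - p) = 2 / 3"
    using assms(7) p by (auto simp: field_simps)
  have \<rho>: "\<rho> \<ge> 1" by (simp add: \<rho>_def)
  have Kf: "Kf \<beta> > 0" "Kf \<beta> powr p = 3 * \<rho> * \<eta> * \<beta>" if "\<beta> > 0" for \<beta>
    using that p \<rho> assms(3) by (auto simp: Kf_def powr_powr)
  have c1: "c1 \<ge> 0" using \<rho> by (auto simp: c1_def intro!: add_nonneg_nonneg mult_nonneg_nonneg)
  have c2: "c2 \<ge> 0" by (simp add: c2_def)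
  have c: "c \<ge> 1" using c1 c2 Kf[of \<beta>0] assms(9) by (simp add: c_def)
  have C: "C \<ge> 0" using c by (simp add: C_def)
  have ln_top: "\<forall>\<^sub>F T in sequentially. z \<le> ln (real T)" for z
    using filterlim_compose[OF ln_at_top filterlim_real_sequentially] by (simp add: filterlim_at_top)
  show ?thesis
  proof (rule exI[of _ C], intro allI impI)
    fix \<beta> \<sigma> \<Delta> :: real
    assume \<beta>: "\<beta> \<ge> \<beta>0" and "\<sigma> \<ge> 0" "\<sigma> \<noteq> 0"
    then have \<sigma>: "\<sigma> > 0" and \<beta>0: "\<beta> > 0" using assms(9) by auto
    define K where "K = Kf \<beta>"
    note K = Kf[OF \<beta>0, folded K_def]
    have K_ge: "Kf \<beta>0 \<le> K"
      unfolding K_def Kf_def using \<beta> \<rho> p assms(3,9) by (intro powr_mono2 mult_left_mono) auto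
    define boot where "boot = (\<lambda>T::nat. (G\<^sup>2 * real T) powr (1 - phat) *
        (44 * (c * ln (real T)) powr (2 / 3) * K powr phat * (\<rho> * real T) powr (phat / 3)) \<le> \<sigma>\<^sup>2 * real T)"
    have ev_boot: "\<forall>\<^sub>F T in sequentially. boot T"
    proof -
      define A where "A = (G\<^sup>2) powr (1 - phat) * (44 * c powr (2 / 3) * K powr phat * \<rho> powr (phat / 3))"
      \<comment> \<open>The powers of T on the left of \<open>boot\<close> have total exponent 1 - 2
        phat / 3, so a margin of 2 phat / 3 is left to beat the logarithm.\<close>
      have "\<forall>\<^sub>F T in sequentially. A * ln (real T) powr (2 / 3) \<le> \<sigma>\<^sup>2 * real T powr (2 * phat / 3)"
        using \<sigma> phat by (intro eventually_log_powr_le) (auto simp: A_def)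
      then show ?thesis
        using eventually_gt_at_top[of 0] ln_top[of 1]
      proof eventually_elim
        case (elim T)
        have "(G\<^sup>2 * real T) powr (1 - phat) *
            (44 * (c * ln (real T)) powr (2 / 3) * K powr phat * (\<rho> * real T) powr (phat / 3))
          = A * ln (real T) powr (2 / 3) * (real T powr (1 - phat) * real T powr (phat / 3))"
          using c \<rho> elim by (simp add: A_def powr_mult)
        also have "\<dots> \<le> \<sigma>\<^sup>2 * real T powr (2 * phat / 3) * (real T powr (1 - phat) * real T powr (phat / 3))"
          using elim by (intro mult_right_mono) auto
        also have "real T powr (2 * phat / 3) * (real T powr (1 - phat) * real T powr (phat / 3)) = real T"
          using elim by (simp flip: powr_add)
        then have "\<sigma>\<^sup>2 * real T powr (2 * phat / 3) * (real T powr (1 - phat) * real T powr (phat / 3)) = \<sigma>\<^sup>2 * real T"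
          by (simp only: mult.assoc)
        finally show ?case by (simp add: boot_def)
      qed
    qed
    have ev_\<sigma>: "\<forall>\<^sub>F T in sequentially. 1 \<le> \<sigma>\<^sup>2 * sqrt (real T)"
    proof -
      have "\<forall>\<^sub>F T in sequentially. 1 / \<sigma>\<^sup>2 \<le> sqrt (real T)"
        using filterlim_compose[OF sqrt_at_top filterlim_real_sequentially] by (simp add: filterlim_at_top)
      then show ?thesis by eventually_elim (use \<sigma> in \<open>simp add: field_simps\<close>)
    qed
    \<comment> \<open>All thresholds depend only on the parameters, \<open>\<beta>\<close>,
      \<open>\<sigma>\<close> and \<open>\<Delta>\<close>, so one \<open>T0\<close> serves every
      problem instance and every run.\<close>
    have "\<forall>\<^sub>F T in sequentially. 1 \<le> T \<and> 1 \<le> ln (real T)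
        \<and> K powr p * \<Delta> / \<eta> / K \<le> ln (real T) \<and> K powr p * (b0 powr (1 / p) / b0) / K \<le> ln (real T)
        \<and> boot T \<and> 1 \<le> \<sigma>\<^sup>2 * sqrt (real T)"
      by (intro eventually_conj ln_top ev_boot ev_\<sigma> eventually_ge_at_top)
    then obtain T0 where T0: "\<And>T. T \<ge> T0 \<Longrightarrow> 1 \<le> T \<and> 1 \<le> ln (real T)
        \<and> K powr p * \<Delta> / \<eta> / K \<le> ln (real T) \<and> K powr p * (b0 powr (1 / p) / b0) / K \<le> ln (real T)
        \<and> boot T \<and> 1 \<le> \<sigma>\<^sup>2 * sqrt (real T)"
      unfolding eventually_sequentially by blast
    show "\<exists>T0. \<forall>(D :: 's measure) (f :: 'a \<Rightarrow> 's \<Rightarrow> real) x1 (M :: 'w measure) \<xi> T x d a b.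
      stochastic_problem D f \<sigma> \<beta> G \<longrightarrow>
      objective D f x1 - optimal_value D f = \<Delta> \<longrightarrow>
      iid_samples M D \<xi> \<longrightarrow>
      (\<forall>\<omega>\<in>space M. meta_storm_sg a0 b0 \<eta> p q f x1 T (\<lambda>t. \<xi> t \<omega>)
         (\<lambda>t. x t \<omega>) (\<lambda>t. d t \<omega>) (\<lambda>t. a t \<omega>) (\<lambda>t. b t \<omega>)) \<longrightarrow>
      T \<ge> T0 \<longrightarrow>
      integrable (output_space M T)
        (\<lambda>(\<omega>, t). norm (gradient (objective D f) (x t \<omega>)) powr (2 * phat)) \<and>
      (\<integral>(\<omega>, t). norm (gradient (objective D f) (x t \<omega>)) powr (2 * phat) \<partial>output_space M T)
        \<le> C * (\<Delta> powr (phat / (1 - p))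
               + \<beta> powr (phat / p) * pos_ln \<beta> powr (phat / (1 - p))
               + \<beta> powr (phat / p) * ln (1 + \<sigma>\<^sup>2 * real T) powr (phat / (1 - p)))
            * (1 / real T powr phat + \<sigma> powr (2 * phat / 3) / real T powr (2 * phat / 3))"
    proof (rule exI[of _ T0], intro allI impI)
      fix D :: "'s measure" and f :: "'a \<Rightarrow> 's \<Rightarrow> real" and x1 and M :: "'w measure" and \<xi> T x d a b
      assume prob: "stochastic_problem D f \<sigma> \<beta> G"
        and \<Delta>: "objective D f x1 - optimal_value D f = \<Delta>"
        and iid: "iid_samples M D \<xi>"
        and run: "\<forall>\<omega>\<in>space M. meta_storm_sg a0 b0 \<eta> p q f x1 T (\<lambda>t. \<xi> t \<omega>)
         (\<lambda>t. x t \<omega>) (\<lambda>t. d t \<omega>) (\<lambda>t. a t \<omega>) (\<lambda>t. b t \<omega>)"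
        and "T \<ge> T0"
      interpret stochastic_problem D f \<sigma> \<beta> G by (rule prob)
      interpret M: prob_space M using iid by (simp add: iid_samples_def)
      interpret run: storm_run D f \<sigma> \<beta> G M \<xi> a0 b0 \<eta> p q x1 T x d a b
        using iid run assms p \<beta>0 by unfold_locales auto
      from T0[OF \<open>T \<ge> T0\<close>] have T: "1 \<le> T" "1 \<le> ln (real T)" "boot T" "1 \<le> \<sigma>\<^sup>2 * sqrt (real T)"
        and T\<Delta>: "K powr p * \<Delta> / \<eta> \<le> K * ln (real T)" "K powr p * (b0 powr (1 / p) / b0) \<le> K * ln (real T)"
        unfolding pos_divide_le_eq[OF K(1)] mult.commute[of K] by blast+
      have phat_eq: "run.phat = phat" using assms(7) by (simp add: run.phat_def)
      have R_eq: "1 + run.R = \<rho>" "run.R = G\<^sup>2 / a0\<^sup>2" by (simp_all add: run.R_def \<rho>_def)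
      have V1: "run.log_const + K powr p * (objective D f x1 - optimal_value D f) / \<eta> + K * run.ell
          \<le> c * ln (real T) * K"
      proof -
        have "run.log_const \<le> c1 * ln (real T)"
          using run.log_const_le[OF T(1,2)] unfolding R_eq(1) unfolding R_eq(2) c1_def .
        also have "\<dots> \<le> c1 / Kf \<beta>0 * K * ln (real T)"
          using mult_left_mono[OF K_ge c1] Kf[of \<beta>0] assms(9) T(2)
          by (intro mult_right_mono) (auto simp: field_simps)
        finally have 1: "run.log_const \<le> c1 / Kf \<beta>0 * K * ln (real T)" .
        have "K * run.ell \<le> K * (c2 * ln (real T))"
          using run.ell_le[OF T(1,2)] K by (intro mult_left_mono) (auto simp: c2_def)
        with 1 T\<Delta>(1) show ?thesis unfolding \<Delta> by (simp add: c_def algebra_simps)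
      qed
      have V2: "K powr p * run.dir_const \<le> c * ln (real T) * K"
      proof -
        have "K * ln (real T) \<le> c * ln (real T) * K"
          using K c T mult_right_mono[of 1 c "K * ln (real T)"] by (simp add: mult_ac)
        with T\<Delta>(2) show ?thesis by (simp add: run.dir_const_def)
      qed
      \<comment> \<open>Comparing with the square root of T bounds ln T by the target logarithm with
        a factor 2 that does not depend on \<open>\<sigma>\<close>.\<close>
      have sqrtT: "sqrt (real T) \<le> \<sigma>\<^sup>2 * real T"
        using mult_right_mono[OF T(4), of "sqrt (real T)"] by (simp add: mult.assoc)
      then have \<sigma>T: "1 \<le> \<sigma>\<^sup>2 * real T"
        using T(1) by (intro order.trans[OF _ sqrtT]) simp
      have lnT: "ln (real T) \<le> 2 * ln (1 + \<sigma>\<^sup>2 * real T)"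
      proof -
        have "ln (real T) = 2 * ln (sqrt (real T))" using T(1) by (simp add: ln_sqrt)
        also have "ln (sqrt (real T)) \<le> ln (1 + \<sigma>\<^sup>2 * real T)"
          using sqrtT T(1) by (subst ln_le_cancel_iff) (auto intro: add_pos_nonneg)
        finally show ?thesis by simp
      qed
      define LN where "LN = ln (1 + \<sigma>\<^sup>2 * real T)"
      have "M.expectation (\<lambda>\<omega>. run.grad_sum \<omega> powr phat)
          \<le> 44 * (c * ln (real T)) powr (2 / 3) * K powr phat * ((1 + 2 / a0\<^sup>2) * (\<sigma>\<^sup>2 * real T)) powr (phat / 3)"
        using run.expected_grad_sum_powr_noise_le[OF T(1,2) K(1) _ c V1 V2 \<sigma>T] K(2) T(3)
        unfolding phat_eq R_eq(1) boot_def by blast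
      also have "\<dots> \<le> 44 * ((2 * c) * LN) powr (2 / 3) * K powr phat * ((1 + 2 / a0\<^sup>2) * (\<sigma>\<^sup>2 * real T)) powr (phat / 3)"
        using lnT c T(2) by (intro mult_right_mono mult_left_mono powr_mono2) (auto simp: LN_def)
      also have "((2 * c) * LN) powr (2 / 3) = (2 * c) powr (2 / 3) * LN powr (2 / 3)"
        using c \<sigma> by (simp add: powr_mult LN_def)
      also have "K powr phat = (3 * \<rho> * \<eta>) powr (phat / p) * \<beta> powr (phat / p)"
        using \<beta>0 \<rho> assms(3) by (simp add: K_def Kf_def powr_powr powr_mult)
      also have "((1 + 2 / a0\<^sup>2) * (\<sigma>\<^sup>2 * real T)) powr (phat / 3)
          = (1 + 2 / a0\<^sup>2) powr (phat / 3) * (\<sigma> powr (2 * phat / 3) * real T powr (phat / 3))"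
      proof -
        have "(\<sigma>\<^sup>2) powr (phat / 3) = (\<sigma> powr 2) powr (phat / 3)" using \<sigma> by simp
        also have "\<dots> = \<sigma> powr (2 * phat / 3)" by (simp only: powr_powr) simp
        finally show ?thesis by (simp add: powr_mult)
      qed
      finally have E: "M.expectation (\<lambda>\<omega>. run.grad_sum \<omega> powr phat)
          \<le> C * (\<beta> powr (phat / p) * LN powr (2 / 3)) * (\<sigma> powr (2 * phat / 3) * real T powr (phat / 3))"
        by (simp add: C_def mult_ac)
      have Tp: "real T powr (phat / 3) / real T powr phat = 1 / real T powr (2 * phat / 3)"
      proof -
        have "real T powr phat = real T powr (phat / 3) * real T powr (2 * phat / 3)"
          by (simp flip: powr_add)
        then show ?thesis using T(1) by simp
      qed
      have "(\<integral>(\<omega>, t). norm (grad_obj (x t \<omega>)) powr (2 * phat) \<partial>output_space M T)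
          \<le> M.expectation (\<lambda>\<omega>. run.grad_sum \<omega> powr phat) / real T powr phat"
        using run.output_expectation(2)[OF T(1)] by (simp only: phat_eq)
      also have "\<dots> \<le> C * (\<beta> powr (phat / p) * LN powr (2 / 3))
          * (\<sigma> powr (2 * phat / 3) * real T powr (phat / 3)) / real T powr phat"
        using E by (intro divide_right_mono) auto
      also have "\<dots> = C * (\<beta> powr (phat / p) * LN powr (2 / 3))
          * (\<sigma> powr (2 * phat / 3) * (real T powr (phat / 3) / real T powr phat))" by simp
      \<comment> \<open>\<open>Tp\<close> identifies the noise part of the rate; both factors are
        then enlarged by nonnegative summands.\<close>
      also have "\<dots> \<le> C * (\<Delta> powr (phat / (1 - p))
               + \<beta> powr (phat / p) * pos_ln \<beta> powr (phat / (1 - p))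
               + \<beta> powr (phat / p) * LN powr (phat / (1 - p)))
            * (1 / real T powr phat + \<sigma> powr (2 * phat / 3) / real T powr (2 * phat / 3))"
        unfolding Tp phat(3) using C by (intro mult_mono mult_left_mono) auto
      finally show "integrable (output_space M T)
            (\<lambda>(\<omega>, t). norm (gradient (objective D f) (x t \<omega>)) powr (2 * phat)) \<and>
          (\<integral>(\<omega>, t). norm (gradient (objective D f) (x t \<omega>)) powr (2 * phat) \<partial>output_space M T)
        \<le> C * (\<Delta> powr (phat / (1 - p))
               + \<beta> powr (phat / p) * pos_ln \<beta> powr (phat / (1 - p))
               + \<beta> powr (phat / p) * ln (1 + \<sigma>\<^sup>2 * real T) powr (phat / (1 - p)))
            * (1 / real T powr phat + \<sigma> powr (2 * phat / 3) / real T powr (2 * phat / 3))"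
        using run.output_expectation(1)[OF T(1)] unfolding phat_eq LN_def by blast
    qed
  qed
qed

end
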